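(* The following are equivalent: (i) for some intensities $\alpha,\beta>0$, two independent Poisson processes on $\mathbb{R}$, one with intensity $\alpha$ and the other with intensity $\beta$, are rough isometric almost surely; (ii) for any intensities $\alpha,\beta>0$, two independent Poisson processes on $\mathbb{R}$, one with intensity $\alpha$ and the other with intensity $\beta$, are rough isometric almost surely; (iii) for some $0<p,q<1$, two independent Bernoulli percolations on $\mathbb{Z}$, one with parameter $p$ and the other with parameter $q$, are rough isometric almost surely; (iv) for any $0<p,q<1$, two independent Bernoulli percolations on $\mathbb{Z}$, one with parameter $p$ and the other with parameter $q$, are rough isometric almost surely.
   Context: A Bernoulli percolation on $\mathbb{Z}$ with parameter $p$ is the random subset of $\mathbb{Z}$ obtained by independently deleting each integer with probability $1-p$. Poisson processes are viewed as random subsets of $\mathbb{R}$, and subsets of $\mathbb{R}$ are viewed as metric spaces with the metric inherited from $\mathbb{R}$. Two metric spaces $X,Y$ are rough isometric if there exist a mapping $T:X\to Y$ and constants $M>0$, $D,R\ge0$ such that: (i) for all $x_1,x_2\in X$, $\frac1M d_X(x_1,x_2)-D\le d_Y(T(x_1),T(x_2))\le M d_X(x_1,x_2)+D$; (ii) for every $y\in Y$ there is $x\in X$ with $d_Y(y,T(x))\le R$. *)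

theory Defs
  imports "HOL-Probability.Probability"
begin

definition rough_isometric :: "'a::metric_space set \<Rightarrow> 'b::metric_space set \<Rightarrow> bool" where
  "rough_isometric X Y \<longleftrightarrow>
     (\<exists>T M D R. T \<in> X \<rightarrow> Y \<and> M > 0 \<and> D \<ge> 0 \<and> R \<ge> 0 \<and>
        (\<forall>x1\<in>X. \<forall>x2\<in>X. 1 / M * dist x1 x2 - D \<le> dist (T x1) (T x2) \<and>
                         dist (T x1) (T x2) \<le> M * dist x1 x2 + D) \<and>
        (\<forall>y\<in>Y. \<exists>x\<in>X. dist y (T x) \<le> R))"

text \<open>
  The measurable space of locally finite subsets of the line, with the \<sigma>-algebra generated by
  the counts in bounded Borel sets. All these counts are of finite sets, so \<^const>\<open>card\<close> is
  the genuine number of points.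
\<close>

definition locally_finite_sets :: "real set set" where
  "locally_finite_sets = {S. \<forall>a b. finite (S \<inter> {a..b})}"

definition point_configurations :: "real set measure" where
  "point_configurations =
     sigma locally_finite_sets
       {{S \<in> locally_finite_sets. card (S \<inter> A) = k} | A k. A \<in> sets borel \<and> bounded A}"

text \<open>
  The Poisson probabilities are written out because \<^const>\<open>poisson_pmf\<close> is specified only for
  a strictly positive rate, while Borel sets of measure \<open>0\<close> have to be allowed here.
\<close>

definition poisson_process :: "'w measure \<Rightarrow> real \<Rightarrow> ('w \<Rightarrow> real set) \<Rightarrow> bool" where
  "poisson_process M \<alpha> X \<longleftrightarrow>
     prob_space M \<and>
     X \<in> M \<rightarrow>\<^sub>M point_configurations \<and>
     (\<forall>A k. A \<in> sets borel \<longrightarrow> bounded A \<longrightarrow>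
        measure M {\<omega> \<in> space M. card (X \<omega> \<inter> A) = k} =
          (\<alpha> * measure lborel A) ^ k / fact k * exp (- (\<alpha> * measure lborel A))) \<and>
     (\<forall>A :: nat \<Rightarrow> real set. (\<forall>i. A i \<in> sets borel \<and> bounded (A i)) \<longrightarrow> disjoint_family A \<longrightarrow>
        prob_space.indep_vars M (\<lambda>_. count_space UNIV) (\<lambda>i \<omega>. card (X \<omega> \<inter> A i)) UNIV)"

definition integer_configurations :: "int set measure" where
  "integer_configurations = sigma UNIV {{S. n \<in> S} | n. True}"

definition bernoulli_percolation :: "'w measure \<Rightarrow> real \<Rightarrow> ('w \<Rightarrow> int set) \<Rightarrow> bool" where
  "bernoulli_percolation M p X \<longleftrightarrow>
     prob_space M \<and>
     X \<in> M \<rightarrow>\<^sub>M integer_configurations \<and>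
     (\<forall>n. measure M {\<omega> \<in> space M. n \<notin> X \<omega>} = 1 - p) \<and>
     prob_space.indep_events M (\<lambda>n. {\<omega> \<in> space M. n \<notin> X \<omega>}) UNIV"

text \<open>
  Almost sure rough isometry depends only on the joint law of the two random sets, hence is required
  of every realisation on a probability space whose outcomes have type \<open>'w\<close>.
\<close>

definition poisson_as_rough_isometric :: "'w itself \<Rightarrow> real \<Rightarrow> real \<Rightarrow> bool" where
  "poisson_as_rough_isometric W \<alpha> \<beta> \<longleftrightarrow>
     (\<forall>(M :: 'w measure) X Y.
        poisson_process M \<alpha> X \<longrightarrow> poisson_process M \<beta> Y \<longrightarrow>
        prob_space.indep_var M point_configurations X point_configurations Y \<longrightarrow>
        (AE \<omega> in M. rough_isometric (X \<omega>) (Y \<omega>)))"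

definition bernoulli_as_rough_isometric :: "'w itself \<Rightarrow> real \<Rightarrow> real \<Rightarrow> bool" where
  "bernoulli_as_rough_isometric W p q \<longleftrightarrow>
     (\<forall>(M :: 'w measure) X Y.
        bernoulli_percolation M p X \<longrightarrow> bernoulli_percolation M q Y \<longrightarrow>
        prob_space.indep_var M integer_configurations X integer_configurations Y \<longrightarrow>
        (AE \<omega> in M. rough_isometric (real_of_int ` X \<omega>) (real_of_int ` Y \<omega>)))"

end

theory Submission
  imports Defs
begin

text \<open>
  Recording which cells \<open>[nL, (n + 1)L)\<close> a Poisson process of intensity \<open>\<alpha>\<close> meets gives a Bernoulli
  percolation with parameter \<open>1 - exp (- \<alpha>L)\<close> that is rough isometric to the process, and by
  choosing \<open>L\<close> (separately for the two processes) every parameter is reached. Hence (iii) implies (ii).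

  For (i) implies (iv), the sites of a percolation \<open>X\<close> provide enough randomness to write down a
  Poisson process \<open>X'\<close> as a function of \<open>X\<close>, on the same probability space. There is no relation
  between the shapes of \<open>X\<close> and \<open>X'\<close>, but the grid of \<open>X'\<close>, for a suitable \<open>L\<close>, has the same law as \<open>X\<close>.
  So it suffices that almost sure rough isometry of two percolations depends only on their joint
  law, which holds because the pairs of rough isometric sets of integers form a measurable set.
\<close>

text \<open>All four statements concern one outcome type \<open>'w\<close>, and the space
  \<open>M\<close> carrying the given percolations may carry no other randomness. So neither a
  richer space nor an auxiliary variable is available: each Poisson process is a measurable function
  of its own percolation, which also keeps the two processes independent. In that function each unit
  cell receives a Poisson number of uniform points. The uniform variables come from disjoint
  infinite sequences of sites: each sequence is read as the digits of a real number, to which its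
  distribution function is applied. That the result is Poisson is checked with joint probability
  generating functions, which turn independence over cells into independence over disjoint Borel
  sets. In the transfer between percolations the obstacle is that the existence of a rough isometry
  quantifies over uncountably many maps. For sets of integers, with a natural number as constant and
  one prescribed value, compactness replaces this by countable quantifiers. Measurability of the
  rough isometry event is needed only for sets of integers.\<close>

section \<open>Rough isometries\<close>

text \<open>Clearing the denominator in the lower bound gives both estimates the same shape, so
  \<open>M\<close>, \<open>D\<close> and \<open>R\<close> merge into one constant. Taking it in
  \<open>nat\<close> leaves only countably many constants to try, which the measurability proof
  relies on.\<close>

lemma rough_isometric_iff:
  "rough_isometric X Y \<longleftrightarrow>
     (\<exists>T (K::nat). T \<in> X \<rightarrow> Y \<and>
        (\<forall>x1\<in>X. \<forall>x2\<in>X. dist x1 x2 \<le> K * dist (T x1) (T x2) + K \<and>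
                         dist (T x1) (T x2) \<le> K * dist x1 x2 + K) \<and>
        (\<forall>y\<in>Y. \<exists>x\<in>X. dist y (T x) \<le> K))" (is "_ \<longleftrightarrow> ?rhs")
proof
  assume "rough_isometric X Y"
  then obtain T M D R where T: "T \<in> X \<rightarrow> Y" and pos: "M > 0" "D \<ge> 0" "R \<ge> 0"
    and b: "\<And>x1 x2. x1\<in>X \<Longrightarrow> x2\<in>X \<Longrightarrow> 1 / M * dist x1 x2 - D \<le> dist (T x1) (T x2)"
      "\<And>x1 x2. x1\<in>X \<Longrightarrow> x2\<in>X \<Longrightarrow> dist (T x1) (T x2) \<le> M * dist x1 x2 + D"
    and s: "\<forall>y\<in>Y. \<exists>x\<in>X. dist y (T x) \<le> R"
    unfolding rough_isometric_def by blast
  obtain K :: nat where "M + M * D + D + R < real K"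
    using reals_Archimedean2 by blast
  moreover have "0 \<le> M * D"
    using pos by simp
  ultimately have K: "M \<le> real K" "M * D \<le> real K" "D \<le> real K" "R \<le> real K"
    using pos by linarith+
  have "dist x1 x2 \<le> K * dist (T x1) (T x2) + K \<and> dist (T x1) (T x2) \<le> K * dist x1 x2 + K"
    if x: "x1 \<in> X" "x2 \<in> X" for x1 x2
  proof
    have "dist x1 x2 \<le> M * dist (T x1) (T x2) + M * D"
      using b(1)[OF x] pos by (simp add: field_simps)
    moreover have "M * dist (T x1) (T x2) \<le> K * dist (T x1) (T x2)"
      "M * dist x1 x2 \<le> K * dist x1 x2"
      using K by (auto intro: mult_right_mono)
    ultimately show "dist x1 x2 \<le> K * dist (T x1) (T x2) + K"
      "dist (T x1) (T x2) \<le> K * dist x1 x2 + K"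
      using K b(2)[OF x] by linarith+
  qed
  moreover have "\<forall>y\<in>Y. \<exists>x\<in>X. dist y (T x) \<le> K"
    using s K(4) by (meson order_trans)
  ultimately show ?rhs
    using T by blast
next
  assume ?rhs
  then obtain T and K :: nat where T: "T \<in> X \<rightarrow> Y"
    and b: "\<And>x1 x2. x1\<in>X \<Longrightarrow> x2\<in>X \<Longrightarrow> dist x1 x2 \<le> K * dist (T x1) (T x2) + K"
      "\<And>x1 x2. x1\<in>X \<Longrightarrow> x2\<in>X \<Longrightarrow> dist (T x1) (T x2) \<le> K * dist x1 x2 + K"
    and s: "\<forall>y\<in>Y. \<exists>x\<in>X. dist y (T x) \<le> K"
    by blast
  \<comment> \<open>The definition wants a positive factor, while \<open>K\<close> may be 0. Being
    at least 1 also gives \<open>L \<le> L * L\<close>, so that the additive error is at most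
    \<open>L\<close> after division by \<open>L\<close>.\<close>
  define L where "L = real K + 1"
  have L: "L > 0" "L \<ge> 0" "K \<le> L" "L \<ge> 1"
    by (auto simp: L_def)
  have "1 / L * dist x1 x2 - L \<le> dist (T x1) (T x2) \<and> dist (T x1) (T x2) \<le> L * dist x1 x2 + L"
    if x: "x1 \<in> X" "x2 \<in> X" for x1 x2
  proof
    have m: "K * dist (T x1) (T x2) \<le> L * dist (T x1) (T x2)" "K * dist x1 x2 \<le> L * dist x1 x2"
      using L by (auto intro: mult_right_mono)
    then have "dist x1 x2 \<le> L * dist (T x1) (T x2) + L * 1"
      using b(1)[OF x] L by linarith
    also have "\<dots> \<le> L * dist (T x1) (T x2) + L * L"
      using L by (intro add_left_mono mult_left_mono) auto
    finally show "1 / L * dist x1 x2 - L \<le> dist (T x1) (T x2)"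
      using L by (simp add: field_simps)
    show "dist (T x1) (T x2) \<le> L * dist x1 x2 + L"
      using b(2)[OF x] L m by linarith
  qed
  moreover have "\<forall>y\<in>Y. \<exists>x\<in>X. dist y (T x) \<le> L"
    using s L(3) by (meson order_trans)
  ultimately show "rough_isometric X Y"
    unfolding rough_isometric_def using T L by blast
qed

lemma rough_isometricI:
  fixes M D R :: real
  assumes T: "T \<in> X \<rightarrow> Y"
    and "\<And>x1 x2. x1 \<in> X \<Longrightarrow> x2 \<in> X \<Longrightarrow> dist x1 x2 \<le> M * dist (T x1) (T x2) + D"
    and "\<And>x1 x2. x1 \<in> X \<Longrightarrow> x2 \<in> X \<Longrightarrow> dist (T x1) (T x2) \<le> M * dist x1 x2 + D"
    and "\<And>y. y \<in> Y \<Longrightarrow> \<exists>x\<in>X. dist y (T x) \<le> R"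
  shows "rough_isometric X Y"
proof -
  obtain K :: nat where K: "max M (max D R) < real K"
    using reals_Archimedean2 by blast
  have "M * d + D \<le> real K * d + real K" if "d \<ge> 0" for d :: real
    using mult_right_mono[of M K d] K that by simp
  then have "\<forall>x1\<in>X. \<forall>x2\<in>X. dist x1 x2 \<le> K * dist (T x1) (T x2) + K \<and>
                         dist (T x1) (T x2) \<le> K * dist x1 x2 + K"
    using assms(2,3) by (meson order_trans zero_le_dist)
  moreover have "\<forall>y\<in>Y. \<exists>x\<in>X. dist y (T x) \<le> K"
  proof
    fix y assume "y \<in> Y"
    then obtain x where "x \<in> X" "dist y (T x) \<le> R"
      using assms(4) by blast
    then show "\<exists>x\<in>X. dist y (T x) \<le> K"
      using K by (intro bexI[of _ x]) auto
  qed
  ultimately show ?thesis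
    unfolding rough_isometric_iff using T by blast
qed

text \<open>The inverse is a choice \<open>S\<close> of near preimages: \<open>T (S y)\<close> lies
  within \<open>K\<close> of \<open>y\<close>, so \<open>S\<close> distorts distances as an inverse
  of \<open>T\<close> would, up to an extra error of \<open>2 * K\<close>.\<close>

lemma rough_isometric_sym:
  assumes "rough_isometric X Y"
  shows "rough_isometric Y X"
proof -
  obtain T and K :: nat where T: "T \<in> X \<rightarrow> Y"
    and b: "\<And>x1 x2. x1\<in>X \<Longrightarrow> x2\<in>X \<Longrightarrow> dist x1 x2 \<le> K * dist (T x1) (T x2) + K"
      "\<And>x1 x2. x1\<in>X \<Longrightarrow> x2\<in>X \<Longrightarrow> dist (T x1) (T x2) \<le> K * dist x1 x2 + K"
    and s: "\<forall>y\<in>Y. \<exists>x\<in>X. dist y (T x) \<le> K"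
    using assms unfolding rough_isometric_iff by blast
  from s obtain S where S: "\<And>y. y \<in> Y \<Longrightarrow> S y \<in> X" "\<And>y. y \<in> Y \<Longrightarrow> dist y (T (S y)) \<le> K"
    by metis
  have tri: "\<bar>dist y1 y2 - dist (T (S y1)) (T (S y2))\<bar> \<le> 2 * real K" if "y1 \<in> Y" "y2 \<in> Y" for y1 y2
  proof -
    have "\<bar>dist y1 y2 - dist (T (S y1)) (T (S y2))\<bar> \<le> dist y1 (T (S y1)) + dist y2 (T (S y2))"
      by metric
    then show ?thesis
      using S(2)[OF that(1)] S(2)[OF that(2)] by linarith
  qed
  \<comment> \<open>\<open>3 * K\<close> is the error \<open>K\<close> of \<open>T\<close> plus
    \<open>2 * K\<close> from \<open>tri\<close>; the other term is \<open>2 * K\<close> passed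
    through the factor \<open>K\<close>. The radius \<open>R\<close> arises because \<open>x\<close>
    and \<open>S (T x)\<close> have images at distance at most \<open>K\<close>.\<close>
  show ?thesis
  proof (rule rough_isometricI[where T = S and M = K and D = "real K * (2 * real K) + 3 * real K"
        and R = "real K * real K + real K"])
    fix y1 y2 assume y: "y1 \<in> Y" "y2 \<in> Y"
    note t = tri[OF y]
    have "dist y1 y2 \<le> K * dist (S y1) (S y2) + 3 * real K"
      using b(2)[OF S(1) S(1), OF y] t by linarith
    moreover have "0 \<le> real K * (2 * real K)"
      by simp
    ultimately show "dist y1 y2 \<le> K * dist (S y1) (S y2) + (real K * (2 * real K) + 3 * real K)"
      by linarith
    have "dist (S y1) (S y2) \<le> K * dist (T (S y1)) (T (S y2)) + K"
      by (rule b(1)[OF S(1) S(1), OF y])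
    also have "\<dots> \<le> K * (dist y1 y2 + 2 * real K) + K"
      using t by (intro add_right_mono mult_left_mono) auto
    finally show "dist (S y1) (S y2) \<le> K * dist y1 y2 + (real K * (2 * real K) + 3 * real K)"
      by (simp add: algebra_simps)
  next
    fix x assume x: "x \<in> X"
    then have y: "T x \<in> Y"
      using T by blast
    have "dist x (S (T x)) \<le> K * dist (T x) (T (S (T x))) + K"
      by (rule b(1)[OF x S(1)[OF y]])
    also have "\<dots> \<le> real K * real K + real K"
      using S(2)[OF y] by (intro add_right_mono mult_left_mono) auto
    finally show "\<exists>y\<in>Y. dist x (S y) \<le> real K * real K + real K"
      using y by auto
  qed (use S in auto)
qed

lemma rough_isometric_trans:
  assumes "rough_isometric X Y" "rough_isometric Y Z"
  shows "rough_isometric X Z"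
proof -
  obtain T and K :: nat where T: "T \<in> X \<rightarrow> Y"
    and b: "\<And>x1 x2. x1\<in>X \<Longrightarrow> x2\<in>X \<Longrightarrow> dist x1 x2 \<le> K * dist (T x1) (T x2) + K"
      "\<And>x1 x2. x1\<in>X \<Longrightarrow> x2\<in>X \<Longrightarrow> dist (T x1) (T x2) \<le> K * dist x1 x2 + K"
    and s: "\<And>y. y\<in>Y \<Longrightarrow> \<exists>x\<in>X. dist y (T x) \<le> K"
    using assms(1) unfolding rough_isometric_iff by blast
  obtain S and L :: nat where S: "S \<in> Y \<rightarrow> Z"
    and c: "\<And>x1 x2. x1\<in>Y \<Longrightarrow> x2\<in>Y \<Longrightarrow> dist x1 x2 \<le> L * dist (S x1) (S x2) + L"
      "\<And>x1 x2. x1\<in>Y \<Longrightarrow> x2\<in>Y \<Longrightarrow> dist (S x1) (S x2) \<le> L * dist x1 x2 + L"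
    and t: "\<And>y. y\<in>Z \<Longrightarrow> \<exists>x\<in>Y. dist y (S x) \<le> L"
    using assms(2) unfolding rough_isometric_iff by blast
  \<comment> \<open>Composing the estimates gives the errors \<open>K * L + K\<close> and
    \<open>L * K + L\<close>, both below \<open>D\<close>. For \<open>R\<close>, a point of
    \<open>Z\<close> is \<open>L\<close>-close to some \<open>S y\<close>, and the error
    \<open>K\<close> in reaching \<open>y\<close> is stretched by \<open>S\<close> to
    \<open>L * K + L\<close>.\<close>
  show ?thesis
  proof (rule rough_isometricI[where T = "S \<circ> T" and M = "real K * real L"
        and D = "real K * real L + real K + real L" and R = "real L + (real L * real K + real L)"])
    show "S \<circ> T \<in> X \<rightarrow> Z"
      using T S by auto
    fix x1 x2 assume x: "x1 \<in> X" "x2 \<in> X"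
    then have y: "T x1 \<in> Y" "T x2 \<in> Y"
      using T by auto
    have "dist x1 x2 \<le> K * dist (T x1) (T x2) + K"
      by (rule b(1)[OF x])
    also have "\<dots> \<le> K * (L * dist (S (T x1)) (S (T x2)) + L) + K"
      using c(1)[OF y] by (intro add_right_mono mult_left_mono) auto
    finally show "dist x1 x2 \<le> (real K * real L) * dist ((S \<circ> T) x1) ((S \<circ> T) x2) + (real K * real L + real K + real L)"
      by (simp add: algebra_simps)
    have "dist (S (T x1)) (S (T x2)) \<le> L * dist (T x1) (T x2) + L"
      by (rule c(2)[OF y])
    also have "\<dots> \<le> L * (K * dist x1 x2 + K) + L"
      using b(2)[OF x] by (intro add_right_mono mult_left_mono) auto
    finally show "dist ((S \<circ> T) x1) ((S \<circ> T) x2) \<le> (real K * real L) * dist x1 x2 + (real K * real L + real K + real L)"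
      by (simp add: algebra_simps)
  next
    fix z assume "z \<in> Z"
    then obtain y where y: "y \<in> Y" "dist z (S y) \<le> L"
      using t by blast
    then obtain x where x: "x \<in> X" "dist y (T x) \<le> K"
      using s by blast
    have "dist (S y) (S (T x)) \<le> L * dist y (T x) + L"
      using c(2) y x T by blast
    also have "\<dots> \<le> real L * real K + real L"
      using x by (intro add_right_mono mult_left_mono) auto
    finally have "dist z (S (T x)) \<le> real L + (real L * real K + real L)"
      using y dist_triangle[of z "S (T x)" "S y"] by linarith
    then show "\<exists>x\<in>X. dist z ((S \<circ> T) x) \<le> real L + (real L * real K + real L)"
      using x by auto
  qed
qed

section \<open>Measurability of rough isometry\<close>

text \<open>Diagonal argument: pigeonhole gives nested infinite index sets \<open>I k\<close> along
  which every point of code below \<open>k\<close> has a constant value, and \<open>g\<close>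
  collects these values. It is a cluster point of the sequence in a product of discrete
  spaces.\<close>

lemma pointwise_cluster_point:
  fixes f :: "nat \<Rightarrow> 'a::countable \<Rightarrow> 'b"
  assumes "\<And>x. finite (range (\<lambda>n. f n x))"
  obtains g where "\<And>F n0. finite F \<Longrightarrow> \<exists>n\<ge>n0. \<forall>x\<in>F. f n x = g x"
proof -
  define P where "P k I \<longleftrightarrow> infinite I \<and>
    (\<forall>x. to_nat x < k \<longrightarrow> (\<exists>c. \<forall>n\<in>I. f n x = c))" for k and I :: "nat set"
  have "\<exists>I. \<forall>k. P k (I k) \<and> I (Suc k) \<subseteq> I k"
  proof (rule dependent_nat_choice)
    show "\<exists>I. P 0 I"
      by (auto simp: P_def intro!: exI[of _ UNIV])
    fix I k assume I: "P k I"
    show "\<exists>J. P (Suc k) J \<and> J \<subseteq> I"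
    proof (cases "\<exists>x::'a. to_nat x = k")
      case True
      then obtain x :: 'a where x: "to_nat x = k" by blast
      have "finite ((\<lambda>n. f n x) ` I)"
        using assms[of x] by (rule finite_subset[rotated]) auto
      then obtain m where m: "infinite {n\<in>I. f n x = f m x}"
        using pigeonhole_infinite[of I "\<lambda>n. f n x"] I by (auto simp: P_def)
      moreover have "y = x" if "to_nat y = k" for y
        using that x by (metis injD inj_to_nat)
      ultimately have "P (Suc k) {n\<in>I. f n x = f m x}"
        using I by (auto simp: P_def less_Suc_eq)
      then show ?thesis by blast
    next
      case False
      then have "P (Suc k) I"
        using I by (auto simp: P_def less_Suc_eq)
      then show ?thesis by blast
    qed
  qed
  then obtain I where I: "\<And>k. P k (I k)" "\<And>k. I (Suc k) \<subseteq> I k"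
    by blast
  have mono: "I l \<subseteq> I k" if "k \<le> l" for k l
    using lift_Suc_antimono_le[of I k l] I(2) that by blast
  have "\<exists>c. \<forall>n\<in>I (Suc (to_nat x)). f n x = c" for x
    using I(1)[of "Suc (to_nat x)"] by (auto simp: P_def)
  then obtain g where g: "\<And>x n. n \<in> I (Suc (to_nat x)) \<Longrightarrow> f n x = g x"
    by metis
  show thesis
  proof (rule that)
    fix F :: "'a set" and n0 :: nat
    assume F: "finite F"
    \<comment> \<open>All codes of points in \<open>F\<close> lie below \<open>k\<close>; the
      inserted 0 makes \<open>Max\<close> meaningful for empty \<open>F\<close>.\<close>
    define k where "k = Suc (Max (insert 0 (to_nat ` F)))"
    have "infinite (I k)"
      using I(1) by (auto simp: P_def)
    then obtain n where n: "n \<ge> n0" "n \<in> I k"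
      by (meson infinite_nat_iff_unbounded_le)
    have "Suc (to_nat x) \<le> k" if "x \<in> F" for x
      using F that by (auto simp: k_def intro!: Max_ge)
    then have "f n x = g x" if "x \<in> F" for x
      using n mono that by (intro g) blast
    then show "\<exists>n\<ge>n0. \<forall>x\<in>F. f n x = g x"
      using n by blast
  qed
qed

text \<open>
  A rough isometry with constants \<open>K\<close> sending \<open>a\<close> to \<open>b\<close> has only finitely many possible values at
  each point, so by compactness it exists as soon as finite pieces of it exist on all windows
  \<open>{-n..n}\<close>. In the last condition the preimage is sought only in the window that can contain it.
\<close>

definition partial_rough_isometry ::
    "nat \<Rightarrow> int \<Rightarrow> int \<Rightarrow> nat \<Rightarrow> int set \<Rightarrow> int set \<Rightarrow> (int \<Rightarrow> int) \<Rightarrow> bool" where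
  "partial_rough_isometry K a b n S S' f \<longleftrightarrow> f a = b \<and>
     (\<forall>x\<in>{-int n..int n}. x \<in> S \<longrightarrow> f x \<in> S') \<and>
     (\<forall>x\<in>{-int n..int n}. \<forall>y\<in>{-int n..int n}. x \<in> S \<longrightarrow> y \<in> S \<longrightarrow>
        \<bar>x - y\<bar> \<le> K * \<bar>f x - f y\<bar> + K \<and> \<bar>f x - f y\<bar> \<le> K * \<bar>x - y\<bar> + K) \<and>
     (\<forall>y. y \<in> S' \<longrightarrow> \<bar>a\<bar> + K * (\<bar>y - b\<bar> + K) + K \<le> n \<longrightarrow>
        (\<exists>x. x \<in> S \<and> \<bar>x - a\<bar> \<le> K * (\<bar>y - b\<bar> + K) + K \<and> \<bar>y - f x\<bar> \<le> K))"

text \<open>Only values on \<open>S\<close> inside the window matter: the guard in the last clause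
  forces every candidate preimage to satisfy \<open>\<bar>x\<bar> \<le> n\<close>. Hence a map can
  be cut off outside the window, or altered off \<open>S\<close>.\<close>

lemma partial_rough_isometry_cong:
  assumes "\<And>x. x \<in> {-int n..int n} \<Longrightarrow> x \<in> S \<Longrightarrow> f x = g x" "a \<in> S" "\<bar>a\<bar> \<le> int n"
    and "partial_rough_isometry K a b n S S' f"
  shows "partial_rough_isometry K a b n S S' g"
  unfolding partial_rough_isometry_def
proof (intro conjI ballI allI impI)
  have fg: "f x = g x" if "\<bar>x\<bar> \<le> int n" "x \<in> S" for x
    using that by (intro assms(1)) auto
  note * = assms(4)[unfolded partial_rough_isometry_def]
  show "g a = b"
    using * fg assms(2,3) by auto
  show "g x \<in> S'" if "x \<in> {-int n..int n}" "x \<in> S" for x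
    using * assms(1) that by metis
  fix x y assume x: "x \<in> {-int n..int n}" "y \<in> {-int n..int n}" "x \<in> S" "y \<in> S"
  show "\<bar>x - y\<bar> \<le> K * \<bar>g x - g y\<bar> + K" "\<bar>g x - g y\<bar> \<le> K * \<bar>x - y\<bar> + K"
    using * assms(1) x by metis+
next
  note * = assms(4)[unfolded partial_rough_isometry_def]
  fix y assume y: "y \<in> S'" "\<bar>a\<bar> + K * (\<bar>y - b\<bar> + K) + K \<le> n"
  then obtain x where x: "x \<in> S" "\<bar>x - a\<bar> \<le> K * (\<bar>y - b\<bar> + K) + K" "\<bar>y - f x\<bar> \<le> K"
    using * by blast
  then have "x \<in> {-int n..int n}"
    using y by auto
  then show "\<exists>x. x \<in> S \<and> \<bar>x - a\<bar> \<le> K * (\<bar>y - b\<bar> + K) + K \<and> \<bar>y - g x\<bar> \<le> K"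
    using x assms(1)[of x] by auto
qed

text \<open>Every quantifier on the right ranges over a countable set, since there are only
  countably many extensional functions on a finite window. The base pair \<open>a\<close>,
  \<open>b\<close> confines the values of the map; it does not exist when \<open>S\<close> is empty,
  hence the separate first case.\<close>

lemma rough_isometric_of_int_iff:
  "rough_isometric (real_of_int ` S) (real_of_int ` S') \<longleftrightarrow>
     (S = {} \<and> S' = {}) \<or>
     (\<exists>K a b. a \<in> S \<and> b \<in> S' \<and>
        (\<forall>n. \<bar>a\<bar> \<le> int n \<longrightarrow>
          (\<exists>f\<in>{-int n..int n} \<rightarrow>\<^sub>E UNIV. partial_rough_isometry K a b n S S' f)))"
  (is "?L \<longleftrightarrow> ?E \<or> ?R")
proof -
  have L_iff: "?L \<longleftrightarrow> (\<exists>f (K::nat). f \<in> S \<rightarrow> S' \<and>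
     (\<forall>x\<in>S. \<forall>y\<in>S. \<bar>x - y\<bar> \<le> K * \<bar>f x - f y\<bar> + K \<and> \<bar>f x - f y\<bar> \<le> K * \<bar>x - y\<bar> + K) \<and>
     (\<forall>y\<in>S'. \<exists>x\<in>S. \<bar>y - f x\<bar> \<le> K))" (is "_ \<longleftrightarrow> ?I")
  proof
    assume ?L
    then obtain T and K :: nat where T: "T \<in> real_of_int ` S \<rightarrow> real_of_int ` S'"
      and b': "\<forall>x1\<in>real_of_int ` S. \<forall>x2\<in>real_of_int ` S. dist x1 x2 \<le> K * dist (T x1) (T x2) + K \<and>
          dist (T x1) (T x2) \<le> K * dist x1 x2 + K"
      and s': "\<forall>y\<in>real_of_int ` S'. \<exists>x\<in>real_of_int ` S. dist y (T x) \<le> K"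
      unfolding rough_isometric_iff by blast
    have b: "\<bar>real_of_int x - real_of_int y\<bar> \<le> K * dist (T x) (T y) + K \<and>
          dist (T x) (T y) \<le> K * \<bar>real_of_int x - real_of_int y\<bar> + K" if "x \<in> S" "y \<in> S" for x y
      using b' that by (auto simp: dist_real_def)
    have s: "\<exists>x\<in>S. dist (real_of_int y) (T x) \<le> K" if "y \<in> S'" for y
      using s' that by auto
    have Tf: "T (real_of_int x) = real_of_int \<lfloor>T x\<rfloor>" "\<lfloor>T x\<rfloor> \<in> S'" if "x \<in> S" for x
      using T that by (auto simp: Pi_iff)
    show ?I
    proof (intro exI[of _ "\<lambda>x. \<lfloor>T (real_of_int x)\<rfloor>"] exI[of _ K] conjI ballI)
      fix x y assume x: "x \<in> S" "y \<in> S"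
      have "\<bar>real_of_int (x - y)\<bar> \<le> K * \<bar>real_of_int (\<lfloor>T x\<rfloor> - \<lfloor>T y\<rfloor>)\<bar> + K \<and>
          \<bar>real_of_int (\<lfloor>T x\<rfloor> - \<lfloor>T y\<rfloor>)\<bar> \<le> K * \<bar>real_of_int (x - y)\<bar> + K"
        using b[OF x] Tf(1)[OF x(1)] Tf(1)[OF x(2)] by (simp add: dist_real_def)
      moreover have "real_of_int (K * \<bar>u\<bar> + K) = K * \<bar>real_of_int u\<bar> + K" for u
        by simp
      ultimately show "\<bar>x - y\<bar> \<le> K * \<bar>\<lfloor>T x\<rfloor> - \<lfloor>T y\<rfloor>\<bar> + K" "\<bar>\<lfloor>T x\<rfloor> - \<lfloor>T y\<rfloor>\<bar> \<le> K * \<bar>x - y\<bar> + K"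
        by (metis of_int_abs of_int_le_iff)+
    next
      fix y assume "y \<in> S'"
      then obtain x where x: "x \<in> S" "dist (real_of_int y) (T x) \<le> K"
        using s by blast
      then have "\<bar>real_of_int (y - \<lfloor>T x\<rfloor>)\<bar> \<le> real_of_int K"
        using Tf(1)[OF x(1)] by (simp add: dist_real_def)
      then show "\<exists>x\<in>S. \<bar>y - \<lfloor>T x\<rfloor>\<bar> \<le> K"
        using x(1) by (metis of_int_abs of_int_le_iff)
    qed (use Tf in auto)
  next
    assume ?I
    then obtain f and K :: nat where f: "f \<in> S \<rightarrow> S'"
      and b: "\<And>x y. x \<in> S \<Longrightarrow> y \<in> S \<Longrightarrow> \<bar>x - y\<bar> \<le> K * \<bar>f x - f y\<bar> + K"
        "\<And>x y. x \<in> S \<Longrightarrow> y \<in> S \<Longrightarrow> \<bar>f x - f y\<bar> \<le> K * \<bar>x - y\<bar> + K"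
      and s: "\<And>y. y \<in> S' \<Longrightarrow> \<exists>x\<in>S. \<bar>y - f x\<bar> \<le> K"
      by blast
    show ?L
    proof (rule rough_isometricI[where T = "\<lambda>x. real_of_int (f \<lfloor>x\<rfloor>)" and M = K and D = K and R = K])
      fix x1 x2 assume "x1 \<in> real_of_int ` S" "x2 \<in> real_of_int ` S"
      then obtain x y where x: "x1 = real_of_int x" "x2 = real_of_int y" "x \<in> S" "y \<in> S"
        by auto
      have "real_of_int \<bar>x - y\<bar> \<le> real_of_int (K * \<bar>f x - f y\<bar> + K)"
        "real_of_int \<bar>f x - f y\<bar> \<le> real_of_int (K * \<bar>x - y\<bar> + K)"
        using b[OF x(3,4)] by (simp_all only: of_int_le_iff)
      then show "dist x1 x2 \<le> K * dist (real_of_int (f \<lfloor>x1\<rfloor>)) (real_of_int (f \<lfloor>x2\<rfloor>)) + K"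
        "dist (real_of_int (f \<lfloor>x1\<rfloor>)) (real_of_int (f \<lfloor>x2\<rfloor>)) \<le> K * dist x1 x2 + K"
        by (simp_all add: x dist_real_def)
    next
      fix y' assume "y' \<in> real_of_int ` S'"
      then obtain y where y: "y' = real_of_int y" "y \<in> S'"
        by auto
      obtain x where x: "x \<in> S" "\<bar>y - f x\<bar> \<le> K"
        using s y by blast
      then have "real_of_int \<bar>y - f x\<bar> \<le> real_of_int (int K)"
        by (simp only: of_int_le_iff)
      then show "\<exists>x\<in>real_of_int ` S. dist y' (real_of_int (f \<lfloor>x\<rfloor>)) \<le> K"
        using x(1) by (intro bexI[of _ "real_of_int x"]) (auto simp: dist_real_def y)
    qed (use f in auto)
  qed
  show ?thesis
    unfolding L_iff
  proof
    assume ?I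
    then obtain f and K :: nat where f: "f \<in> S \<rightarrow> S'"
      and b: "\<And>x y. x \<in> S \<Longrightarrow> y \<in> S \<Longrightarrow> \<bar>x - y\<bar> \<le> K * \<bar>f x - f y\<bar> + K"
        "\<And>x y. x \<in> S \<Longrightarrow> y \<in> S \<Longrightarrow> \<bar>f x - f y\<bar> \<le> K * \<bar>x - y\<bar> + K"
      and s: "\<And>y. y \<in> S' \<Longrightarrow> \<exists>x\<in>S. \<bar>y - f x\<bar> \<le> K"
      by blast
    show "?E \<or> ?R"
    proof (cases "S = {}")
      case True
      then show ?thesis using s by auto
    next
      case False
      then obtain a where a: "a \<in> S" by blast
      have pri: "partial_rough_isometry K a (f a) n S S' f" for n
        unfolding partial_rough_isometry_def
      proof (intro conjI ballI allI impI)
        fix y assume "y \<in> S'" "\<bar>a\<bar> + K * (\<bar>y - f a\<bar> + K) + K \<le> n"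
        then obtain x where x: "x \<in> S" "\<bar>y - f x\<bar> \<le> K"
          using s by blast
        \<comment> \<open>Origin of the radius in \<open>partial_rough_isometry\<close>: a near
          preimage of \<open>y\<close> has its image within \<open>K\<close> of \<open>y\<close>, so
          it cannot be far from \<open>a\<close>.\<close>
        have "\<bar>x - a\<bar> \<le> K * \<bar>f x - f a\<bar> + K"
          by (rule b(1)[OF x(1) a])
        also have "\<dots> \<le> K * (\<bar>y - f a\<bar> + K) + K"
          using x(2) by (intro add_right_mono mult_left_mono) linarith+
        finally show "\<exists>x. x \<in> S \<and> \<bar>x - a\<bar> \<le> K * (\<bar>y - f a\<bar> + K) + K \<and> \<bar>y - f x\<bar> \<le> K"
          using x by blast
      qed (use f b in auto)
      have "\<exists>g\<in>{-int n..int n} \<rightarrow>\<^sub>E UNIV. partial_rough_isometry K a (f a) n S S' g"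
        if "\<bar>a\<bar> \<le> int n" for n
        using pri[of n] that a
        by (intro bexI[of _ "restrict f {-int n..int n}"]
              partial_rough_isometry_cong[of n S f "restrict f {-int n..int n}"]) auto
      then show ?thesis
        using a f by (intro disjI2 exI[of _ K] exI[of _ a] exI[of _ "f a"]) auto
    qed
  next
    assume "?E \<or> ?R"
    then show ?I
    proof
      assume ?E then show ?I by auto
    next
      assume ?R
      then obtain K a b where a: "a \<in> S" "b \<in> S'"
        and ex: "\<And>n. \<bar>a\<bar> \<le> int n \<Longrightarrow>
          \<exists>f\<in>{-int n..int n} \<rightarrow>\<^sub>E UNIV. partial_rough_isometry K a b n S S' f"
        by blast
      have "\<exists>f. \<bar>a\<bar> \<le> int n \<longrightarrow> partial_rough_isometry K a b n S S' f" for n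
        using ex by blast
      then obtain h where h: "\<And>n. \<bar>a\<bar> \<le> int n \<Longrightarrow> partial_rough_isometry K a b n S S' (h n)"
        by metis
      \<comment> \<open>The default \<open>b\<close>, used off \<open>S\<close>, outside the window
        and for windows missing \<open>a\<close>, keeps each value in an interval around
        \<open>b\<close> that does not depend on \<open>n\<close>, as the cluster point lemma
        demands.\<close>
      define f where "f n x = (if x \<in> S \<and> \<bar>x\<bar> \<le> int n \<and> \<bar>a\<bar> \<le> int n then h n x else b)" for n x
      have f: "partial_rough_isometry K a b n S S' (f n)" if "\<bar>a\<bar> \<le> int n" for n
        by (rule partial_rough_isometry_cong[OF _ a(1) that h[OF that]]) (use that in \<open>auto simp: f_def\<close>)
      have "f n x \<in> {b - (K * \<bar>x - a\<bar> + K)..b + (K * \<bar>x - a\<bar> + K)}" for n x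
      proof (cases "x \<in> S \<and> \<bar>x\<bar> \<le> int n \<and> \<bar>a\<bar> \<le> int n")
        case True
        moreover from True have "x \<in> {-int n..int n}" "a \<in> {-int n..int n}"
          by auto
        ultimately have "\<bar>f n x - f n a\<bar> \<le> K * \<bar>x - a\<bar> + K" "f n a = b"
          using f[of n] a unfolding partial_rough_isometry_def by blast+
        then show ?thesis
          by auto
      next
        case False
        then have "f n x = b" by (auto simp: f_def)
        moreover have "0 \<le> K * \<bar>x - a\<bar>" by simp
        ultimately show ?thesis unfolding atLeastAtMost_iff by linarith
      qed
      then have "finite (range (\<lambda>n. f n x))" for x
        by (intro finite_subset[OF image_subsetI finite_atLeastAtMost_int])
      then obtain g where g: "\<And>F n0. finite F \<Longrightarrow> \<exists>n\<ge>n0. \<forall>x\<in>F. f n x = g x"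
        using pointwise_cluster_point by metis
      have win: "\<exists>n. n \<ge> n0 \<and> \<bar>a\<bar> \<le> int n \<and> (\<forall>x\<in>F. f n x = g x)" if "finite F" for F n0
        using g[OF that, of "max n0 (nat \<bar>a\<bar>)"] by auto
      show ?I
      proof (intro exI[of _ g] exI[of _ K] conjI ballI funcsetI)
        fix x assume x: "x \<in> S"
        obtain n where n: "n \<ge> nat \<bar>x\<bar>" "\<bar>a\<bar> \<le> int n" "f n x = g x"
          using win[of "{x}"] by auto
        moreover from n(1) have "x \<in> {-int n..int n}" by auto
        ultimately show "g x \<in> S'"
          using f[of n] x unfolding partial_rough_isometry_def by metis
      next
        fix x y assume x: "x \<in> S" "y \<in> S"
        obtain n where n: "n \<ge> nat \<bar>x\<bar> + nat \<bar>y\<bar>" "\<bar>a\<bar> \<le> int n" "f n x = g x" "f n y = g y"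
          using win[of "{x, y}"] by auto
        moreover from n(1) have "x \<in> {-int n..int n}" "y \<in> {-int n..int n}" by auto
        ultimately show "\<bar>x - y\<bar> \<le> K * \<bar>g x - g y\<bar> + K" "\<bar>g x - g y\<bar> \<le> K * \<bar>x - y\<bar> + K"
          using f[of n] x unfolding partial_rough_isometry_def by metis+
      next
        fix y assume y: "y \<in> S'"
        \<comment> \<open>The near preimage found for \<open>f n\<close> depends on
          \<open>n\<close>, but it always lies in \<open>{a-r..a+r}\<close>. So \<open>f n\<close>
          is made to agree with \<open>g\<close> on this whole finite interval.\<close>
        define r where "r = K * (\<bar>y - b\<bar> + K) + K"
        obtain n where n: "n \<ge> nat (\<bar>a\<bar> + r)" "\<bar>a\<bar> \<le> int n" "\<And>x. x \<in> {a-r..a+r} \<Longrightarrow> f n x = g x"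
          using win[OF finite_atLeastAtMost_int, of "nat (\<bar>a\<bar> + r)" "a - r" "a + r"] by blast
        have "\<bar>a\<bar> + K * (\<bar>y - b\<bar> + K) + K \<le> n"
          using n(1) by (simp add: r_def)
        then obtain x where x: "x \<in> S" "\<bar>x - a\<bar> \<le> r" "\<bar>y - f n x\<bar> \<le> K"
          using f[OF n(2)] y unfolding partial_rough_isometry_def r_def by blast
        then have "f n x = g x"
          by (intro n(3)) auto
        then show "\<exists>x\<in>S. \<bar>y - g x\<bar> \<le> K"
          using x by auto
      qed
    qed
  qed
qed

section \<open>The rough isometry event in the space of integer configurations\<close>

lemma space_integer_configurations [simp]: "space integer_configurations = UNIV"
  by (simp add: integer_configurations_def space_measure_of_conv)

lemma pred_mem_integer_configurations [measurable]:
  "Measurable.pred integer_configurations (\<lambda>S. n \<in> S)"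
  unfolding pred_def by (auto simp: integer_configurations_def space_measure_of_conv)

text \<open>After the reduction to countable quantifiers, the remaining conditions mention the two
  sets only through membership of single integers, and such conditions generate the
  \<sigma>-algebra.\<close>

lemma pred_rough_isometric_of_int:
  "Measurable.pred (integer_configurations \<Otimes>\<^sub>M integer_configurations)
     (\<lambda>z. rough_isometric (real_of_int ` fst z) (real_of_int ` snd z))"
proof -
  have empty: "S = {} \<longleftrightarrow> (\<forall>n. n \<notin> S)" for S :: "int set"
    by auto
  have fs[measurable]: "Measurable.pred (integer_configurations \<Otimes>\<^sub>M integer_configurations) (\<lambda>z. n \<in> fst z)"
    "Measurable.pred (integer_configurations \<Otimes>\<^sub>M integer_configurations) (\<lambda>z. n \<in> snd z)" for n
    by measurable
  have cnt: "countable ({-int n..int n} \<rightarrow>\<^sub>E (UNIV :: int set))" for n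
    by (rule countable_PiE) auto
  have "Measurable.pred (integer_configurations \<Otimes>\<^sub>M integer_configurations)
     (\<lambda>z. \<exists>f\<in>{-int n..int n} \<rightarrow>\<^sub>E UNIV. partial_rough_isometry K a b n (fst z) (snd z) f)" for n K a b
    unfolding partial_rough_isometry_def pred_def by (intro sets.sets_Collect_countable_Ex' cnt) measurable
  note [measurable] = this
  show ?thesis
    unfolding rough_isometric_of_int_iff empty by measurable
qed

section \<open>From Poisson processes to percolations\<close>

lemma space_point_configurations [simp]: "space point_configurations = locally_finite_sets"
  by (simp add: point_configurations_def space_measure_of_conv)

lemma sets_point_configurations_card:
  assumes "A \<in> sets borel" "bounded A"
  shows "{S \<in> locally_finite_sets. card (S \<inter> A) = k} \<in> sets point_configurations"
proof -
  have "{{S \<in> locally_finite_sets. card (S \<inter> A) = k} | A k. A \<in> sets borel \<and> bounded A} \<subseteq> Pow locally_finite_sets"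
    by auto
  then show ?thesis
    using assms by (auto simp: point_configurations_def)
qed

lemma finite_locally_finite_Int_bounded:
  assumes "S \<in> locally_finite_sets" "bounded A"
  shows "finite (S \<inter> A)"
proof -
  obtain a where "A \<subseteq> {-a..a}"
    using bounded_subset_cbox_symmetric[OF assms(2)] by auto
  moreover have "finite (S \<inter> {-a..a})"
    using assms(1) by (auto simp: locally_finite_sets_def)
  ultimately show ?thesis
    by (meson Int_mono finite_subset order_refl)
qed

text \<open>For \<open>L > 0\<close> the half-open cells partition the line, so each point
  determines exactly one cell, that of number \<open>\<lfloor>x / L\<rfloor>\<close>.\<close>

definition grid :: "real \<Rightarrow> real set \<Rightarrow> int set" where
  "grid L S = {n. S \<inter> {real_of_int n * L..<(real_of_int n + 1) * L} \<noteq> {}}"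

lemma mem_cell_iff:
  assumes "L > 0"
  shows "x \<in> {real_of_int n * L..<(real_of_int n + 1) * L} \<longleftrightarrow> \<lfloor>x / L\<rfloor> = n"
  using assms by (auto simp: floor_eq_iff field_simps)

text \<open>A point goes to the number of its cell. Apart from the scaling by \<open>1 / L\<close>,
  rounding changes distances by at most 1. The constants are sums so as to serve both inequalities,
  and every occupied cell is hit, so \<open>R = 0\<close>.\<close>

lemma rough_isometric_grid:
  assumes "L > 0"
  shows "rough_isometric S (real_of_int ` grid L S)"
proof (rule rough_isometricI[where T = "\<lambda>x. real_of_int \<lfloor>x / L\<rfloor>" and M = "L + 1 / L" and D = "L + 1" and R = 0])
  show "(\<lambda>x. real_of_int \<lfloor>x / L\<rfloor>) \<in> S \<rightarrow> real_of_int ` grid L S"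
  proof
    fix x assume "x \<in> S"
    then have "\<lfloor>x / L\<rfloor> \<in> grid L S"
      unfolding grid_def using mem_cell_iff[OF assms, of x "\<lfloor>x / L\<rfloor>"] by blast
    then show "real_of_int \<lfloor>x / L\<rfloor> \<in> real_of_int ` grid L S" by blast
  qed
  fix x y assume "x \<in> S" "y \<in> S"
  have *: "\<bar>\<bar>x / L - y / L\<bar> - \<bar>real_of_int \<lfloor>x / L\<rfloor> - real_of_int \<lfloor>y / L\<rfloor>\<bar>\<bar> \<le> 1"
    by linarith
  have eq: "\<bar>x / L - y / L\<bar> = \<bar>x - y\<bar> / L"
    using assms by (simp add: diff_divide_distrib[symmetric])
  let ?d = "\<bar>real_of_int \<lfloor>x / L\<rfloor> - real_of_int \<lfloor>y / L\<rfloor>\<bar>"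
  have "\<bar>x - y\<bar> / L \<le> ?d + 1" "?d \<le> 1 / L * \<bar>x - y\<bar> + 1"
    using * eq by auto
  then have "\<bar>x - y\<bar> \<le> L * ?d + L" "?d \<le> 1 / L * \<bar>x - y\<bar> + 1"
    using assms by (simp_all add: field_simps)
  moreover have "0 \<le> 1 / L * ?d" "0 \<le> L * \<bar>x - y\<bar>"
    using assms by auto
  ultimately show "dist x y \<le> (L + 1 / L) * dist (real_of_int \<lfloor>x / L\<rfloor>) (real_of_int \<lfloor>y / L\<rfloor>) + (L + 1)"
    "dist (real_of_int \<lfloor>x / L\<rfloor>) (real_of_int \<lfloor>y / L\<rfloor>) \<le> (L + 1 / L) * dist x y + (L + 1)"
    using assms unfolding dist_real_def distrib_right by linarith+
next
  fix y assume "y \<in> real_of_int ` grid L S"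
  then obtain n x where "y = real_of_int n" "x \<in> S" "x \<in> {real_of_int n * L..<(real_of_int n + 1) * L}"
    unfolding grid_def by blast
  then show "\<exists>x\<in>S. dist y (real_of_int \<lfloor>x / L\<rfloor>) \<le> 0"
    using mem_cell_iff[OF assms, of x n] by auto
qed

text \<open>Local finiteness matters here: \<open>card\<close> would also be 0 for an infinite
  intersection.\<close>

lemma not_mem_grid_iff_card:
  assumes "S \<in> locally_finite_sets"
  shows "n \<notin> grid L S \<longleftrightarrow> card (S \<inter> {real_of_int n * L..<(real_of_int n + 1) * L}) = 0"
  using finite_locally_finite_Int_bounded[OF assms, of "{real_of_int n * L..<(real_of_int n + 1) * L}"]
  by (auto simp: grid_def)

lemma measurable_grid [measurable]: "grid L \<in> point_configurations \<rightarrow>\<^sub>M integer_configurations"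
  unfolding integer_configurations_def
proof (rule measurable_measure_of)
  fix A :: "int set set" assume "A \<in> {{S. n \<in> S} |n. True}"
  then obtain n where A: "A = {S. n \<in> S}" by blast
  have "grid L -` A \<inter> locally_finite_sets = locally_finite_sets -
      {S \<in> locally_finite_sets. card (S \<inter> {real_of_int n * L..<(real_of_int n + 1) * L}) = 0}"
    using not_mem_grid_iff_card by (auto simp: A)
  moreover have "\<dots> \<in> sets point_configurations"
    using sets.compl_sets[OF sets_point_configurations_card[of "{real_of_int n * L..<(real_of_int n + 1) * L}" 0]]
    by simp
  ultimately show "grid L -` A \<inter> space point_configurations \<in> sets point_configurations"
    by simp
qed auto

text \<open>A cell is empty with probability \<open>exp (- (\<alpha> * L))\<close>, and counts in
  disjoint cells are independent. The definition of a Poisson process offers independence for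
  families indexed by \<open>nat\<close>, so the cells are enumerated by
  \<open>int_decode\<close>.\<close>

lemma bernoulli_percolation_grid:
  assumes X: "poisson_process M \<alpha> X" and "\<alpha> > 0" "L > 0"
  shows "bernoulli_percolation M (1 - exp (- (\<alpha> * L))) (\<lambda>\<omega>. grid L (X \<omega>))"
proof -
  let ?C = "\<lambda>n. {real_of_int n * L..<(real_of_int n + 1) * L}"
  interpret prob_space M
    using X by (simp add: poisson_process_def)
  have meas: "X \<in> M \<rightarrow>\<^sub>M point_configurations"
    using X by (simp add: poisson_process_def)
  have lf: "X \<omega> \<in> locally_finite_sets" if "\<omega> \<in> space M" for \<omega>
    using measurable_space[OF meas that] by simp
  have void: "{\<omega> \<in> space M. n \<notin> grid L (X \<omega>)} = {\<omega> \<in> space M. card (X \<omega> \<inter> ?C n) = 0}" for n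
    using not_mem_grid_iff_card lf by blast
  have disj: "disjoint_family (\<lambda>i. ?C (int_decode i))"
  proof (unfold disjoint_family_on_def, safe)
    fix i j x assume "i \<noteq> j" "x \<in> ?C (int_decode i)" "x \<in> ?C (int_decode j)"
    then have "int_decode i = int_decode j"
      unfolding mem_cell_iff[OF \<open>L > 0\<close>] by simp
    then show "x \<in> {}"
      using \<open>i \<noteq> j\<close> by (metis int_decode_inverse)
  qed
  have "indep_vars (\<lambda>_. count_space UNIV) (\<lambda>i \<omega>. card (X \<omega> \<inter> ?C (int_decode i))) UNIV"
    using X disj by (auto simp: poisson_process_def)
  then have ind: "prob (\<Inter>j\<in>J. (\<lambda>\<omega>. card (X \<omega> \<inter> ?C (int_decode j))) -` {0} \<inter> space M) =
      (\<Prod>j\<in>J. prob ((\<lambda>\<omega>. card (X \<omega> \<inter> ?C (int_decode j))) -` {0} \<inter> space M))"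
    if "finite J" "J \<noteq> {}" for J
    using that by (intro indep_varsD) auto
  have "indep_events (\<lambda>n. {\<omega> \<in> space M. n \<notin> grid L (X \<omega>)}) UNIV"
  proof (rule indep_eventsI)
    show "{\<omega> \<in> space M. n \<notin> grid L (X \<omega>)} \<in> events" for n
      using meas by measurable
    fix J :: "int set" assume J: "finite J" "J \<noteq> {}"
    have eq: "(\<lambda>\<omega>. card (X \<omega> \<inter> ?C n)) -` {0} \<inter> space M = {\<omega> \<in> space M. n \<notin> grid L (X \<omega>)}" for n
      unfolding void by auto
    have "inj_on int_encode J"
      by (simp add: inj_int_encode)
    then show "prob (\<Inter>n\<in>J. {\<omega> \<in> space M. n \<notin> grid L (X \<omega>)}) = (\<Prod>n\<in>J. prob {\<omega> \<in> space M. n \<notin> grid L (X \<omega>)})"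
      using ind[of "int_encode ` J"] J by (simp add: prod.reindex eq)
  qed
  moreover have "prob {\<omega> \<in> space M. n \<notin> grid L (X \<omega>)} = exp (- (\<alpha> * L))" for n
  proof -
    have "measure lborel (?C n) = L"
      using \<open>L > 0\<close> by (simp add: algebra_simps)
    moreover have "prob {\<omega> \<in> space M. card (X \<omega> \<inter> ?C n) = 0} =
       (\<alpha> * measure lborel (?C n)) ^ 0 / fact 0 * exp (- (\<alpha> * measure lborel (?C n)))"
      using X unfolding poisson_process_def
      by (elim conjE allE[of _ "?C n"] allE[of _ 0] impE) auto
    ultimately show ?thesis
      unfolding void by simp
  qed
  ultimately show ?thesis
    unfolding bernoulli_percolation_def using meas prob_space_axioms by auto
qed

section \<open>The law of a percolation\<close>

text \<open>The void events are stable under intersection, unlike the generators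
  \<open>{S. n \<in> S}\<close>, so a probability law on configurations is determined by its void
  probabilities.\<close>

lemma sets_integer_configurations_void:
  "sets integer_configurations = sigma_sets UNIV {{S. S \<inter> J = {}} | J. finite J}"
proof -
  have "sigma_sets UNIV {{S. n \<in> S} | n::int. True} = sigma_sets UNIV {{S. S \<inter> J = {}} | J. finite J}" (is "?l = ?r")
  proof (intro sigma_sets_eqI)
    fix A assume "A \<in> {{S. n \<in> S} | n::int. True}"
    then obtain n where A: "A = UNIV - {S. S \<inter> {n} = {}}" by auto
    show "A \<in> ?r"
      unfolding A by (rule sigma_sets.Compl, rule sigma_sets.Basic) blast
  next
    fix A :: "int set set" assume "A \<in> {{S. S \<inter> J = {}} | J. finite J}"
    then obtain J where J: "finite J" "A = {S. S \<inter> J = {}}" by auto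
    interpret sigma_algebra UNIV ?l by (rule sigma_algebra_sigma_sets) auto
    have "{S. n \<notin> S} \<in> ?l" for n
    proof -
      have "{S. n \<notin> S} = UNIV - {S. n \<in> S}" by auto
      moreover have "\<dots> \<in> ?l"
        by (rule sigma_sets.Compl, rule sigma_sets.Basic) blast
      ultimately show ?thesis by simp
    qed
    then have "{S \<in> UNIV. \<forall>n\<in>J. n \<notin> S} \<in> ?l"
      by (intro sets_Collect_finite_All) (use J in auto)
    moreover have "A = {S \<in> UNIV. \<forall>n\<in>J. n \<notin> S}"
      unfolding J(2) by auto
    ultimately show "A \<in> ?l"
      by simp
  qed
  then show ?thesis
    by (simp add: integer_configurations_def)
qed

lemma bernoulli_percolation_void_prob:
  assumes "bernoulli_percolation M p X" "finite J"
  shows "measure M {\<omega> \<in> space M. X \<omega> \<inter> J = {}} = (1 - p) ^ card J"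
proof (cases "J = {}")
  case True
  interpret prob_space M using assms by (simp add: bernoulli_percolation_def)
  show ?thesis using True prob_space by simp
next
  case False
  interpret prob_space M using assms by (simp add: bernoulli_percolation_def)
  have "{\<omega> \<in> space M. X \<omega> \<inter> J = {}} = (\<Inter>n\<in>J. {\<omega> \<in> space M. n \<notin> X \<omega>})"
    using False by auto
  also have "prob \<dots> = (\<Prod>n\<in>J. prob {\<omega> \<in> space M. n \<notin> X \<omega>})"
    using assms False unfolding bernoulli_percolation_def indep_events_def by blast
  finally show ?thesis
    using assms by (simp add: bernoulli_percolation_def)
qed

lemma bernoulli_percolation_distr_unique:
  assumes X: "bernoulli_percolation M p X" and Y: "bernoulli_percolation N p Y"
  shows "distr M integer_configurations X = distr N integer_configurations Y"
proof (rule measure_eqI_generator_eq[where \<Omega> = UNIV and A = "\<lambda>_. UNIV" and E = "{{S. S \<inter> J = {}} | J. finite J}"])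
  interpret M: prob_space M using X by (simp add: bernoulli_percolation_def)
  interpret N: prob_space N using Y by (simp add: bernoulli_percolation_def)
  have mX: "X \<in> M \<rightarrow>\<^sub>M integer_configurations" and mY: "Y \<in> N \<rightarrow>\<^sub>M integer_configurations"
    using X Y by (auto simp: bernoulli_percolation_def)
  show "Int_stable {{S::int set. S \<inter> J = {}} | J. finite J}"
  proof (safe intro!: Int_stableI)
    fix J K :: "int set" assume "finite J" "finite K"
    then show "\<exists>L. {S. S \<inter> J = {}} \<inter> {S. S \<inter> K = {}} = {S. S \<inter> L = {}} \<and> finite L"
      by (intro exI[of _ "J \<union> K"]) auto
  qed
  show "emeasure (distr M integer_configurations X) A = emeasure (distr N integer_configurations Y) A"
    if "A \<in> {{S. S \<inter> J = {}} | J. finite J}" for A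
  proof -
    from that obtain J where J: "finite J" "A = {S. S \<inter> J = {}}" by auto
    have A: "A \<in> sets integer_configurations"
      unfolding sets_integer_configurations_void using that by (rule sigma_sets.Basic)
    have "X -` A \<inter> space M = {\<omega> \<in> space M. X \<omega> \<inter> J = {}}" "Y -` A \<inter> space N = {\<omega> \<in> space N. Y \<omega> \<inter> J = {}}"
      by (auto simp: J)
    then show ?thesis
      using bernoulli_percolation_void_prob[OF X J(1)] bernoulli_percolation_void_prob[OF Y J(1)]
      by (simp add: emeasure_distr mX mY A M.emeasure_eq_measure N.emeasure_eq_measure)
  qed
  show "emeasure (distr M integer_configurations X) UNIV \<noteq> \<infinity>"
    using finite_measure.emeasure_finite[OF prob_space.finite_measure[OF M.prob_space_distr[OF mX]]]
    by simp
  have "{S::int set. S \<inter> {} = {}} = UNIV" by simp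
  then show "range (\<lambda>_::nat. UNIV) \<subseteq> {{S::int set. S \<inter> J = {}} | J. finite J}"
    by blast
qed (auto simp: sets_integer_configurations_void)

lemma bernoulli_pair_distr_unique:
  assumes "bernoulli_percolation M p X" "bernoulli_percolation M q Y"
      "prob_space.indep_var M integer_configurations X integer_configurations Y"
    and "bernoulli_percolation N p X'" "bernoulli_percolation N q Y'"
      "prob_space.indep_var N integer_configurations X' integer_configurations Y'"
  shows "distr M (integer_configurations \<Otimes>\<^sub>M integer_configurations) (\<lambda>\<omega>. (X \<omega>, Y \<omega>)) =
         distr N (integer_configurations \<Otimes>\<^sub>M integer_configurations) (\<lambda>\<omega>. (X' \<omega>, Y' \<omega>))"
proof -
  interpret M: prob_space M using assms(1) by (simp add: bernoulli_percolation_def)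
  interpret N: prob_space N using assms(4) by (simp add: bernoulli_percolation_def)
  show ?thesis
    using assms(3,6) bernoulli_percolation_distr_unique[OF assms(1,4)] bernoulli_percolation_distr_unique[OF assms(2,5)]
    unfolding M.indep_var_distribution_eq N.indep_var_distribution_eq by simp
qed

text \<open>Both pairs have the same joint law. Passing an almost sure statement to the law and back
  requires its event to be measurable, which is what the compactness argument secures.\<close>

lemma AE_rough_isometric_bernoulli_transfer:
  assumes X: "bernoulli_percolation M p X" and Y: "bernoulli_percolation M q Y"
    and XY: "prob_space.indep_var M integer_configurations X integer_configurations Y"
    and X': "bernoulli_percolation N p X'" and Y': "bernoulli_percolation N q Y'"
    and XY': "prob_space.indep_var N integer_configurations X' integer_configurations Y'"
    and AE: "AE \<omega> in N. rough_isometric (real_of_int ` X' \<omega>) (real_of_int ` Y' \<omega>)"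
  shows "AE \<omega> in M. rough_isometric (real_of_int ` X \<omega>) (real_of_int ` Y \<omega>)"
proof -
  let ?P = "integer_configurations \<Otimes>\<^sub>M integer_configurations"
  have m: "{z \<in> space ?P. rough_isometric (real_of_int ` fst z) (real_of_int ` snd z)} \<in> sets ?P"
    using pred_rough_isometric_of_int by (simp add: pred_def)
  have mX[measurable]: "X \<in> M \<rightarrow>\<^sub>M integer_configurations" "Y \<in> M \<rightarrow>\<^sub>M integer_configurations"
     "X' \<in> N \<rightarrow>\<^sub>M integer_configurations" "Y' \<in> N \<rightarrow>\<^sub>M integer_configurations"
    using X Y X' Y' by (auto simp: bernoulli_percolation_def)
  have mp: "(\<lambda>\<omega>. (X \<omega>, Y \<omega>)) \<in> M \<rightarrow>\<^sub>M ?P" "(\<lambda>\<omega>. (X' \<omega>, Y' \<omega>)) \<in> N \<rightarrow>\<^sub>M ?P"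
    by measurable
  have "AE z in distr N ?P (\<lambda>\<omega>. (X' \<omega>, Y' \<omega>)). rough_isometric (real_of_int ` fst z) (real_of_int ` snd z)"
    using AE by (simp add: AE_distr_iff[OF mp(2) m])
  then have "AE z in distr M ?P (\<lambda>\<omega>. (X \<omega>, Y \<omega>)). rough_isometric (real_of_int ` fst z) (real_of_int ` snd z)"
    unfolding bernoulli_pair_distr_unique[OF X Y XY X' Y' XY'] .
  then show ?thesis
    by (simp add: AE_distr_iff[OF mp(1) m])
qed

section \<open>Comparison of the two models through their grids\<close>

lemma indep_var_grid:
  assumes "poisson_process M \<alpha> X" "prob_space.indep_var M point_configurations X point_configurations Y"
  shows "prob_space.indep_var M integer_configurations (\<lambda>\<omega>. grid L (X \<omega>)) integer_configurations (\<lambda>\<omega>. grid L' (Y \<omega>))"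
proof -
  interpret prob_space M using assms by (simp add: poisson_process_def)
  show ?thesis
    using indep_var_compose[OF assms(2) measurable_grid measurable_grid] by (simp add: comp_def)
qed

lemma grid_parameter:
  assumes "\<alpha> > 0" "0 < p" "p < 1"
  obtains L :: real where "L > 0" "1 - exp (- (\<alpha> * L)) = p"
  using assms by (intro that[of "- ln (1 - p) / \<alpha>"]) (auto simp: field_simps)

lemma rough_isometric_grid_iff:
  assumes "L > 0" "L' > 0"
  shows "rough_isometric (real_of_int ` grid L S) (real_of_int ` grid L' S') \<longleftrightarrow> rough_isometric S S'"
proof
  note S = rough_isometric_grid[OF assms(1), of S] and S' = rough_isometric_grid[OF assms(2), of S']
  show "rough_isometric S S'" if "rough_isometric (real_of_int ` grid L S) (real_of_int ` grid L' S')"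
    by (rule rough_isometric_trans[OF S rough_isometric_trans[OF that rough_isometric_sym[OF S']]])
  show "rough_isometric (real_of_int ` grid L S) (real_of_int ` grid L' S')" if "rough_isometric S S'"
    by (rule rough_isometric_trans[OF rough_isometric_sym[OF S] rough_isometric_trans[OF that S']])
qed

lemma poisson_if_bernoulli:
  assumes "bernoulli_as_rough_isometric TYPE('w) p q" "0 < p" "p < 1" "0 < q" "q < 1" "0 < \<alpha>" "0 < \<beta>"
  shows "poisson_as_rough_isometric TYPE('w) \<alpha> \<beta>"
  unfolding poisson_as_rough_isometric_def
proof safe
  fix M :: "'w measure" and X Y
  assume XY: "poisson_process M \<alpha> X" "poisson_process M \<beta> Y"
    "prob_space.indep_var M point_configurations X point_configurations Y"
  obtain L where L: "L > 0" "1 - exp (- (\<alpha> * L)) = p"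
    using grid_parameter assms by metis
  obtain L' where L': "L' > 0" "1 - exp (- (\<beta> * L')) = q"
    using grid_parameter assms by metis
  have "bernoulli_percolation M p (\<lambda>\<omega>. grid L (X \<omega>))" "bernoulli_percolation M q (\<lambda>\<omega>. grid L' (Y \<omega>))"
    using bernoulli_percolation_grid[OF XY(1) \<open>0 < \<alpha>\<close> L(1)]
      bernoulli_percolation_grid[OF XY(2) \<open>0 < \<beta>\<close> L'(1)] by (simp_all only: L L')
  then have "AE \<omega> in M. rough_isometric (real_of_int ` grid L (X \<omega>)) (real_of_int ` grid L' (Y \<omega>))"
    using assms(1) indep_var_grid[OF XY(1,3)] by (auto simp: bernoulli_as_rough_isometric_def)
  then show "AE \<omega> in M. rough_isometric (X \<omega>) (Y \<omega>)"
    by (simp add: rough_isometric_grid_iff L L')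
qed

section \<open>Uniform variables from a percolation\<close>

text \<open>Independence is given only for the deletion events. A family consisting of one event is
  intersection-stable, so independence extends to the generated \<sigma>-algebras, which contain
  every event expressible through \<open>n \<in> X \<omega>\<close>.\<close>

lemma bernoulli_percolation_indep_vars:
  assumes X: "bernoulli_percolation M p X"
  shows "prob_space.indep_vars M (\<lambda>_. count_space UNIV) (\<lambda>n \<omega>. n \<in> X \<omega>) UNIV"
proof -
  interpret prob_space M using X by (simp add: bernoulli_percolation_def)
  have mX[measurable]: "X \<in> M \<rightarrow>\<^sub>M integer_configurations"
    using X by (simp add: bernoulli_percolation_def)
  have meas: "(\<lambda>\<omega>. n \<in> X \<omega>) \<in> M \<rightarrow>\<^sub>M count_space UNIV" for n
    by measurable
  have "indep_sets (\<lambda>n. {{\<omega> \<in> space M. n \<notin> X \<omega>}}) UNIV"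
    using X by (simp add: bernoulli_percolation_def indep_events_def_alt)
  then have "indep_sets (\<lambda>n. sigma_sets (space M) {{\<omega> \<in> space M. n \<notin> X \<omega>}}) UNIV"
    by (rule indep_sets_sigma) (auto simp: Int_stable_def)
  moreover have "(\<lambda>\<omega>. n \<in> X \<omega>) -` A \<inter> space M \<in> sigma_sets (space M) {{\<omega> \<in> space M. n \<notin> X \<omega>}}" for n A
  proof -
    interpret S: sigma_algebra "space M" "sigma_sets (space M) {{\<omega> \<in> space M. n \<notin> X \<omega>}}"
      by (rule sigma_algebra_sigma_sets) auto
    have E: "{\<omega> \<in> space M. n \<notin> X \<omega>} \<in> sigma_sets (space M) {{\<omega> \<in> space M. n \<notin> X \<omega>}}"
      by (rule sigma_sets.Basic) simp
    have "(\<lambda>\<omega>. n \<in> X \<omega>) -` A \<inter> space M =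
      (if True \<in> A then space M - {\<omega> \<in> space M. n \<notin> X \<omega>} else {}) \<union>
      (if False \<in> A then {\<omega> \<in> space M. n \<notin> X \<omega>} else {})"
      by (intro set_eqI, rename_tac \<omega>, case_tac "n \<in> X \<omega>") auto
    also have "\<dots> \<in> sigma_sets (space M) {{\<omega> \<in> space M. n \<notin> X \<omega>}}"
      by (intro S.Un) (simp_all only: if_True if_False S.compl_sets[OF E] E S.empty_sets split: if_split, simp_all)
    finally show ?thesis .
  qed
  then have "{(\<lambda>\<omega>. n \<in> X \<omega>) -` A \<inter> space M | A. A \<in> sets (count_space UNIV)}
      \<subseteq> sigma_sets (space M) {{\<omega> \<in> space M. n \<notin> X \<omega>}}" for n
    by blast
  ultimately have "indep_sets (\<lambda>n. {(\<lambda>\<omega>. n \<in> X \<omega>) -` A \<inter> space M | A. A \<in> sets (count_space UNIV)}) UNIV"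
    by (rule indep_sets_mono_sets)
  then show ?thesis
    unfolding indep_vars_def2 using meas by simp
qed

text \<open>With digits of modulus at most 1, everything after the leading term contributes at most
  \<open>1/3 * 3/2 = 1/2\<close>, so a vanishing sum forces the integer \<open>d 0\<close> to be 0,
  and the shifted series vanishes again. In base 2 the tail could reach 1 and the argument would
  break.\<close>

lemma ternary_digits_zero:
  fixes d :: "nat \<Rightarrow> int"
  assumes "\<And>k. \<bar>d k\<bar> \<le> 1" "(\<Sum>k. real_of_int (d k) * (1/3)^k) = 0"
  shows "d k = 0"
proof -
  have bnd: "summable (\<lambda>k. real_of_int (d k) * (1/3)^k)" "\<bar>\<Sum>k. real_of_int (d k) * (1/3)^k\<bar> \<le> 3 / 2"
    if "\<And>k. \<bar>d k\<bar> \<le> 1" for d :: "nat \<Rightarrow> int"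
  proof -
    have g: "(\<lambda>k. (1/3::real)^k) sums (3/2)"
      using geometric_sums[of "1/3::real"] by simp
    have le: "norm (real_of_int (d k) * (1/3)^k) \<le> (1/3)^k" for k
      using that[of k] by (auto simp: abs_mult mult_left_le_one_le)
    show "summable (\<lambda>k. real_of_int (d k) * (1/3)^k)"
      by (rule summable_comparison_test'[OF sums_summable[OF g] le])
    show "\<bar>\<Sum>k. real_of_int (d k) * (1/3)^k\<bar> \<le> 3 / 2"
      using norm_suminf_le[OF le sums_summable[OF g]] by (simp only: sums_unique[OF g, symmetric] real_norm_def)
  qed
  have dstep: "d 0 = 0 \<and> (\<Sum>k. real_of_int (d (Suc k)) * (1/3)^k) = 0"
    if d: "\<And>k. \<bar>d k\<bar> \<le> 1" "(\<Sum>k. real_of_int (d k) * (1/3)^k) = 0" for d :: "nat \<Rightarrow> int"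
  proof -
    let ?s = "\<Sum>k. real_of_int (d (Suc k)) * (1/3)^k"
    have "(\<lambda>k. real_of_int (d (Suc k)) * (1/3)^k) sums ?s"
      by (rule summable_sums[OF bnd(1)]) (rule d(1))
    then have "(\<lambda>k. 1/3 * (real_of_int (d (Suc k)) * (1/3)^k)) sums (1/3 * ?s)"
      by (rule sums_mult)
    also have "(\<lambda>k. 1/3 * (real_of_int (d (Suc k)) * (1/3)^k)) = (\<lambda>k. real_of_int (d (Suc k)) * (1/3)^Suc k)"
      by (intro ext) (simp only: power_Suc mult.left_commute)
    finally have "(\<lambda>k. real_of_int (d k) * (1/3)^k) sums (1/3 * ?s + real_of_int (d 0) * (1/3)^0)"
      by (subst (asm) sums_Suc_iff)
    from sums_unique[OF this] have eq: "real_of_int (d 0) + 1/3 * ?s = 0"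
      unfolding d(2) by simp
    moreover have "\<bar>?s\<bar> \<le> 3/2"
      by (rule bnd(2)) (rule d(1))
    ultimately have "\<bar>real_of_int (d 0)\<bar> < 1"
      by linarith
    then have "d 0 = 0" by linarith
    then show ?thesis using eq by (intro conjI) linarith+
  qed
  show ?thesis
    using assms
  proof (induction k arbitrary: d)
    case 0
    show ?case using dstep[of d, OF 0] by (rule conjunct1)
  next
    case (Suc k)
    have "(\<Sum>k. real_of_int (d (Suc k)) * (1/3)^k) = 0"
      using dstep[of d, OF Suc.prems] by (rule conjunct2)
    then show ?case
      by (rule Suc.IH[of "\<lambda>k. d (Suc k)", OF Suc.prems(1)])
  qed
qed

text \<open>Base \<open>3\<close> rather than \<open>2\<close>, so that the digits are determined by the sum.\<close>

definition ternary_sum :: "(nat \<Rightarrow> bool) \<Rightarrow> real" where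
  "ternary_sum b = (\<Sum>k. of_bool (b k) * (1/3)^k)"

lemma inj_ternary_sum: "inj ternary_sum"
proof (rule injI)
  fix b c assume eq: "ternary_sum b = ternary_sum c"
  have sm: "summable (\<lambda>k. of_bool (b k) * (1/3::real)^k)" for b :: "nat \<Rightarrow> bool"
    by (rule summable_comparison_test'[OF summable_geometric[of "1/3::real"]]) auto
  have "(\<Sum>k. real_of_int (of_bool (b k) - of_bool (c k)) * (1/3)^k) = ternary_sum b - ternary_sum c"
    unfolding ternary_sum_def suminf_diff[OF sm sm] by (simp add: algebra_simps)
  then have "of_bool (b k) - of_bool (c k) = (0::int)" for k
    using eq by (intro ternary_digits_zero[of "\<lambda>k. of_bool (b k) - of_bool (c k)"]) auto
  then show "b = c"
    by (intro ext) (metis eq_iff_diff_eq_0 of_bool_eq_iff)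
qed

section \<open>The probability integral transform\<close>

context prob_space
begin

text \<open>Without atoms the distribution function is continuous and takes every value strictly
  between 0 and 1, but it may be flat on intervals and so has no inverse. Comparing the events
  \<open>?F (Z \<omega>) \<le> v\<close> and \<open>Z \<omega> \<le> x\<close>, where
  \<open>?F x\<close> equals \<open>v\<close> or a slightly larger number, avoids inverting
  it.\<close>

lemma prob_cdf_le:
  assumes Z[measurable]: "Z \<in> borel_measurable M"
    and atomless: "\<And>z. prob {\<omega> \<in> space M. Z \<omega> = z} = 0"
    and u: "0 \<le> u" "u \<le> 1"
  shows "prob {\<omega> \<in> space M. cdf (distr M borel Z) (Z \<omega>) \<le> u} = u"
proof -
  interpret D: real_distribution "distr M borel Z"
    by (rule real_distribution_distr) simp
  let ?F = "cdf (distr M borel Z)"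
  have F: "?F x = prob {\<omega> \<in> space M. Z \<omega> \<le> x}" for x
    unfolding cdf_def by (subst measure_distr) (auto intro!: arg_cong[of _ _ prob])
  have [measurable]: "?F \<in> borel_measurable borel"
    by (rule borel_measurable_mono) (auto intro!: monoI D.cdf_nondecreasing)
  have "measure (distr M borel Z) {x} = 0" for x
    using atomless[of x] by (subst measure_distr) (auto simp: vimage_def Int_def conj_commute)
  then have cont: "isCont ?F x" for x
    by (simp add: D.isCont_cdf)
  have ivt: "\<exists>x. ?F x = v" if "0 < v" "v < 1" for v
  proof -
    have "eventually (\<lambda>x. ?F x < v) at_bot" "eventually (\<lambda>x. v < ?F x) at_top"
      using order_tendstoD[OF D.cdf_lim_at_bot] order_tendstoD[OF D.cdf_lim_at_top_prob] that by auto
    then obtain a b where ab: "\<And>x. x \<le> a \<Longrightarrow> ?F x < v" "\<And>x. b \<le> x \<Longrightarrow> v < ?F x"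
      unfolding eventually_at_bot_linorder eventually_at_top_linorder by blast
    have "\<exists>x\<ge>min a b. x \<le> max a b \<and> ?F x = v"
      using ab(1)[of "min a b"] ab(2)[of "max a b"] cont by (intro IVT) auto
    then show ?thesis by blast
  qed
  define G where "G v = prob {\<omega> \<in> space M. ?F (Z \<omega>) \<le> v}" for v
  have Gmono: "G v \<le> G w" if "v \<le> w" for v w
    unfolding G_def using that by (intro finite_measure_mono) auto
  have le: "G v \<le> w" if v: "v < w" "0 < w" "w < 1" for v w
  proof -
    obtain x where x: "?F x = w" using ivt[OF v(2,3)] by blast
    have "G v \<le> ?F x"
      unfolding G_def F[of x]
    proof (intro finite_measure_mono subsetI)
      fix \<omega> assume "\<omega> \<in> {\<omega> \<in> space M. ?F (Z \<omega>) \<le> v}"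
      then show "\<omega> \<in> {\<omega> \<in> space M. Z \<omega> \<le> x}"
        using D.cdf_nondecreasing[of x "Z \<omega>"] x v by (cases "Z \<omega> \<le> x") auto
    qed auto
    then show ?thesis using x by simp
  qed
  have ge: "v \<le> G v" if v: "0 < v" "v < 1" for v
  proof -
    obtain x where x: "?F x = v" using ivt[OF v] by blast
    have "?F x \<le> G v"
      unfolding G_def F[of x]
    proof (intro finite_measure_mono subsetI)
      fix \<omega> assume "\<omega> \<in> {\<omega> \<in> space M. Z \<omega> \<le> x}"
      then show "\<omega> \<in> {\<omega> \<in> space M. ?F (Z \<omega>) \<le> v}"
        using D.cdf_nondecreasing[of "Z \<omega>" x] x by auto
    qed auto
    then show ?thesis using x by simp
  qed
  have "G u \<le> u"
  proof (cases "u = 1")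
    case True then show ?thesis by (simp add: G_def)
  next
    case False
    show ?thesis
    proof (rule field_le_epsilon)
      fix e :: real assume "e > 0"
      \<comment> \<open>The intermediate value theorem only reaches values strictly below 1, so the
        bound is kept under \<open>(u + 1) / 2\<close> as well. Below, \<open>u / 2\<close> likewise
        keeps the argument positive.\<close>
      have "G u \<le> min (u + e) ((u + 1) / 2)"
        using u False \<open>e > 0\<close> by (intro le) (auto simp: min_less_iff_disj)
      then show "G u \<le> u + e" by simp
    qed
  qed
  moreover have "u \<le> G u"
  proof (cases "u = 0")
    case True then show ?thesis by (simp add: G_def)
  next
    case False
    show ?thesis
    proof (rule field_le_epsilon)
      fix e :: real assume "e > 0"
      have "max (u - e) (u / 2) \<le> G (max (u - e) (u / 2))"
        using u False \<open>e > 0\<close> by (intro ge) (auto simp: less_max_iff_disj)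
      also have "\<dots> \<le> G u"
        using u \<open>e > 0\<close> by (intro Gmono) auto
      finally show "u \<le> G u + e" by simp
    qed
  qed
  ultimately show ?thesis by (simp add: G_def)
qed

end

text \<open>This is the form of the density delivered by
  \<open>uniform_distrI_borel_atLeastAtMost\<close>; the denominator equals 1.\<close>

abbreviation (in prob_space) uniform01 :: "('a \<Rightarrow> real) \<Rightarrow> bool" where
  "uniform01 U \<equiv> distributed M lborel U (\<lambda>x. indicator {0..1} x / measure lborel {0..1::real})"

text \<open>By injectivity of \<open>ternary_sum\<close>, one value fixes the state of all sites
  \<open>f k\<close>. These are distinct sites and each prescribed state has probability at most
  \<open>r < 1\<close>, so the first \<open>m + 1\<close> of them leave at most
  \<open>r ^ Suc m\<close>.\<close>

lemma ternary_sum_atomless: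
  assumes X: "bernoulli_percolation M p X" and p: "0 < p" "p < 1" and f: "inj f"
  shows "measure M {\<omega> \<in> space M. ternary_sum (\<lambda>k. f k \<in> X \<omega>) = z} = 0"
proof -
  interpret prob_space M using X by (simp add: bernoulli_percolation_def)
  have mX[measurable]: "X \<in> M \<rightarrow>\<^sub>M integer_configurations"
    using X by (simp add: bernoulli_percolation_def)
  have ind: "indep_vars (\<lambda>_. count_space UNIV) (\<lambda>n \<omega>. n \<in> X \<omega>) UNIV"
    by (rule bernoulli_percolation_indep_vars[OF X])
  define r where "r = max p (1 - p)"
  have r: "0 \<le> r" "r < 1" using p by (auto simp: r_def)
  have site: "prob {\<omega> \<in> space M. (n \<in> X \<omega>) = b} \<le> r" for n b
  proof -
    have "prob {\<omega> \<in> space M. n \<notin> X \<omega>} = 1 - p"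
      using X by (simp add: bernoulli_percolation_def)
    moreover have "prob {\<omega> \<in> space M. n \<in> X \<omega>} = 1 - prob {\<omega> \<in> space M. n \<notin> X \<omega>}"
      by (subst prob_neg[symmetric]) auto
    ultimately show ?thesis by (cases b) (auto simp: r_def)
  qed
  show ?thesis
  proof (cases "\<exists>\<omega>0\<in>space M. ternary_sum (\<lambda>k. f k \<in> X \<omega>0) = z")
    case False
    then have "{\<omega> \<in> space M. ternary_sum (\<lambda>k. f k \<in> X \<omega>) = z} = {}" by auto
    then show ?thesis by (simp only: measure_empty)
  next
    case True
    then obtain \<omega>0 where z: "z = ternary_sum (\<lambda>k. f k \<in> X \<omega>0)" by auto
    have bound: "prob {\<omega> \<in> space M. ternary_sum (\<lambda>k. f k \<in> X \<omega>) = z} \<le> r ^ Suc m" for m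
    proof -
      let ?J = "f ` {..m}"
      have J: "card ?J = Suc m" "finite ?J" "?J \<noteq> {}"
        using f by (auto simp: card_image inj_on_subset)
      have "prob {\<omega> \<in> space M. ternary_sum (\<lambda>k. f k \<in> X \<omega>) = z} \<le>
        prob (\<Inter>n\<in>?J. (\<lambda>\<omega>. n \<in> X \<omega>) -` {n \<in> X \<omega>0} \<inter> space M)"
      proof (intro finite_measure_mono subsetI)
        fix \<omega> assume "\<omega> \<in> {\<omega> \<in> space M. ternary_sum (\<lambda>k. f k \<in> X \<omega>) = z}"
        then have "\<omega> \<in> space M" "(\<lambda>k. f k \<in> X \<omega>) = (\<lambda>k. f k \<in> X \<omega>0)"
          using injD[OF inj_ternary_sum] by (auto simp: z)
        then show "\<omega> \<in> (\<Inter>n\<in>?J. (\<lambda>\<omega>. n \<in> X \<omega>) -` {n \<in> X \<omega>0} \<inter> space M)"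
          by (auto dest: fun_cong)
      next
        show "(\<Inter>n\<in>?J. (\<lambda>\<omega>. n \<in> X \<omega>) -` {n \<in> X \<omega>0} \<inter> space M) \<in> events"
          using J by (intro sets.finite_INT) (auto intro!: measurable_sets[of _ M "count_space UNIV"])
      qed
      also have "\<dots> = (\<Prod>n\<in>?J. prob ((\<lambda>\<omega>. n \<in> X \<omega>) -` {n \<in> X \<omega>0} \<inter> space M))"
        using J by (intro indep_varsD[OF ind]) auto
      also have "\<dots> \<le> (\<Prod>n\<in>?J. r)"
      proof (intro prod_mono conjI)
        fix n
        have "(\<lambda>\<omega>. n \<in> X \<omega>) -` {n \<in> X \<omega>0} \<inter> space M = {\<omega> \<in> space M. (n \<in> X \<omega>) = (n \<in> X \<omega>0)}"
          by auto
        then show "prob ((\<lambda>\<omega>. n \<in> X \<omega>) -` {n \<in> X \<omega>0} \<inter> space M) \<le> r"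
          using site by simp
      qed auto
      finally show ?thesis using J by simp
    qed
    have "(\<lambda>m. r ^ Suc m) \<longlonglongrightarrow> 0"
      using r LIMSEQ_Suc[OF LIMSEQ_power_zero[of r]] by simp
    then have "prob {\<omega> \<in> space M. ternary_sum (\<lambda>k. f k \<in> X \<omega>) = z} \<le> 0"
      by (rule LIMSEQ_le_const) (use bound in blast)
    then show ?thesis
      using measure_nonneg by (metis order_antisym)
  qed
qed

text \<open>The variables are functions of configurations rather than of outcomes, with values in
  \<open>{0..1}\<close> on every configuration, so that the point sets built from them are locally
  finite and measurable on the whole configuration space.\<close>

lemma bernoulli_percolation_uniforms:
  fixes X :: "'w \<Rightarrow> int set"
  assumes X: "bernoulli_percolation M p X" and p: "0 < p" "p < 1"
  obtains U :: "'i::countable \<Rightarrow> int set \<Rightarrow> real" where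
    "\<And>i. U i \<in> borel_measurable integer_configurations" "\<And>i S. U i S \<in> {0..1}"
    "prob_space.indep_vars M (\<lambda>_. borel) (\<lambda>i \<omega>. U i (X \<omega>)) UNIV"
    "\<And>i. prob_space.uniform01 M (\<lambda>\<omega>. U i (X \<omega>))"
proof -
  interpret prob_space M using X by (simp add: bernoulli_percolation_def)
  have mX[measurable]: "X \<in> M \<rightarrow>\<^sub>M integer_configurations"
    using X by (simp add: bernoulli_percolation_def)
  define f :: "'i \<Rightarrow> nat \<Rightarrow> int" where "f i k = int_decode (prod_encode (to_nat i, k))" for i k
  have f_eq: "f i k = f j l \<longleftrightarrow> i = j \<and> k = l" for i j k l
    by (auto simp: f_def inj_eq[OF inj_int_decode] inj_eq[OF inj_prod_encode])
  define Z where "Z i S = ternary_sum (\<lambda>k. f i k \<in> S)" for i S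
  have mZ[measurable]: "Z i \<in> borel_measurable integer_configurations" for i
    unfolding Z_def ternary_sum_def by measurable
  define F where "F i = cdf (distr M borel (\<lambda>\<omega>. Z i (X \<omega>)))" for i
  have D: "real_distribution (distr M borel (\<lambda>\<omega>. Z i (X \<omega>)))" for i
    by (rule real_distribution_distr) simp
  have mF[measurable]: "F i \<in> borel_measurable borel" for i
    unfolding F_def
    by (rule borel_measurable_mono)
      (auto intro!: monoI finite_borel_measure.cdf_nondecreasing real_distribution.finite_borel_measure_M D)
  have atomless: "prob {\<omega> \<in> space M. Z i (X \<omega>) = z} = 0" for i z
    unfolding Z_def by (rule ternary_sum_atomless[OF X p]) (auto simp: inj_def f_eq)
  show thesis
  proof (rule that[of "\<lambda>i S. F i (Z i S)"])
    show "(\<lambda>S. F i (Z i S)) \<in> borel_measurable integer_configurations" for i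
      by measurable
    show "F i (Z i S) \<in> {0..1}" for i S
      unfolding F_def using finite_borel_measure.cdf_nonneg[OF real_distribution.finite_borel_measure_M[OF D]]
        real_distribution.cdf_bounded_prob[OF D] by auto
    show "uniform01 (\<lambda>\<omega>. F i (Z i (X \<omega>)))" for i
    proof (rule uniform_distrI_borel_atLeastAtMost)
      fix t :: real assume "0 \<le> t" "t \<le> 1"
      then show "prob {\<omega> \<in> space M. F i (Z i (X \<omega>)) \<le> t} = (t - 0) / (1 - 0)"
        unfolding F_def using prob_cdf_le[of "\<lambda>\<omega>. Z i (X \<omega>)" t] atomless by simp
    qed auto
    \<comment> \<open>The \<open>i\<close>-th variable reads only the sites in \<open>?K i\<close>.
      These blocks are disjoint, and disjoint blocks of independent sites are independent.\<close>
    let ?K = "\<lambda>i. range (f i)"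
    have "indep_vars (\<lambda>i. PiM (?K i) (\<lambda>_. count_space UNIV)) (\<lambda>i \<omega>. restrict (\<lambda>n. n \<in> X \<omega>) (?K i)) UNIV"
      by (rule indep_vars_restrict[OF bernoulli_percolation_indep_vars[OF X]])
        (auto simp: disjoint_family_on_def f_eq)
    then have "indep_vars (\<lambda>_. borel) (\<lambda>i \<omega>. F i (ternary_sum (\<lambda>k. restrict (\<lambda>n. n \<in> X \<omega>) (?K i) (f i k)))) UNIV"
    proof (rule indep_vars_compose2)
      fix i
      have [measurable]: "(\<lambda>g. g (f i k)) \<in> PiM (?K i) (\<lambda>_. count_space UNIV) \<rightarrow>\<^sub>M count_space (UNIV :: bool set)" for k
        by (rule measurable_component_singleton) simp
      show "(\<lambda>g. F i (ternary_sum (\<lambda>k. g (f i k)))) \<in> borel_measurable (PiM (?K i) (\<lambda>_. count_space UNIV))"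
        unfolding ternary_sum_def by measurable
    qed
    then show "indep_vars (\<lambda>_. borel) (\<lambda>i \<omega>. F i (Z i (X \<omega>))) UNIV"
      by (simp add: Z_def)
  qed
qed

section \<open>Joint generating functions\<close>

text \<open>There are at least \<open>m\<close> points in \<open>A\<close> iff some \<open>m\<close>
  active indices have pairwise distinct values in \<open>A\<close>; distinctness is demanded because
  different indices may produce the same point. Only countably many finite index sets occur, and a
  count is \<open>k\<close> when it is at least \<open>k\<close> but not at least
  \<open>k + 1\<close>.\<close>

lemma measurable_point_set:
  fixes V :: "'i::countable \<Rightarrow> 'a \<Rightarrow> real"
  assumes [measurable]: "\<And>i. V i \<in> borel_measurable M" "\<And>i. Measurable.pred M (act i)"
    and lf: "\<And>\<omega>. \<omega> \<in> space M \<Longrightarrow> {V i \<omega> | i. act i \<omega>} \<in> locally_finite_sets"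
  shows "(\<lambda>\<omega>. {V i \<omega> | i. act i \<omega>}) \<in> M \<rightarrow>\<^sub>M point_configurations"
  unfolding point_configurations_def
proof (rule measurable_measure_of)
  fix B assume "B \<in> {{S \<in> locally_finite_sets. card (S \<inter> A) = k} | A k. A \<in> sets borel \<and> bounded A}"
  then obtain A k where B: "B = {S \<in> locally_finite_sets. card (S \<inter> A) = k}"
    and A[measurable]: "A \<in> sets borel" and "bounded A" by blast
  let ?X = "\<lambda>\<omega>. {V i \<omega> | i. act i \<omega>}"
  define P where "P m \<omega> \<longleftrightarrow> (\<exists>J\<in>{J. finite J \<and> card J = m}. \<forall>i\<in>J. act i \<omega> \<and> V i \<omega> \<in> A \<and>
      (\<forall>j\<in>J. i \<noteq> j \<longrightarrow> V i \<omega> \<noteq> V j \<omega>))" for m \<omega>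
  have P: "P m \<omega> \<longleftrightarrow> m \<le> card (?X \<omega> \<inter> A)" if "\<omega> \<in> space M" for m \<omega>
  proof
    have fin: "finite (?X \<omega> \<inter> A)"
      using finite_locally_finite_Int_bounded lf that \<open>bounded A\<close> by blast
    show "m \<le> card (?X \<omega> \<inter> A)" if "P m \<omega>"
    proof -
      from that obtain J where J: "finite J" "card J = m"
        "\<And>i. i \<in> J \<Longrightarrow> act i \<omega> \<and> V i \<omega> \<in> A" "\<And>i j. i \<in> J \<Longrightarrow> j \<in> J \<Longrightarrow> i \<noteq> j \<Longrightarrow> V i \<omega> \<noteq> V j \<omega>"
        unfolding P_def by blast
      have "inj_on (\<lambda>i. V i \<omega>) J"
        using J(4) by (auto simp: inj_on_def)
      then have "m = card ((\<lambda>i. V i \<omega>) ` J)"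
        using J by (simp add: card_image)
      also have "\<dots> \<le> card (?X \<omega> \<inter> A)"
        using J(3) by (intro card_mono fin) auto
      finally show ?thesis .
    qed
    show "P m \<omega>" if le: "m \<le> card (?X \<omega> \<inter> A)"
    proof -
      obtain T where T: "T \<subseteq> ?X \<omega> \<inter> A" "card T = m" "finite T"
        using obtain_subset_with_card_n[OF le] by blast
      have "T \<subseteq> (\<lambda>i. V i \<omega>) ` {i. act i \<omega> \<and> V i \<omega> \<in> A}"
        using T(1) by blast
      then obtain J where J: "J \<subseteq> {i. act i \<omega> \<and> V i \<omega> \<in> A}" "inj_on (\<lambda>i. V i \<omega>) J" "T = (\<lambda>i. V i \<omega>) ` J"
        by (meson subset_image_inj)
      then have "finite J" "card J = m"
        using T finite_image_iff[OF J(2)] card_image[OF J(2)] by auto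
      then show ?thesis
        unfolding P_def using J(1,2) by (intro bexI[of _ J]) (auto simp: inj_on_def)
    qed
  qed
  have cnt: "countable {J::'i set. finite J \<and> card J = m}" for m
    by (rule countable_subset[OF _ countable_Collect_finite]) auto
  have [measurable]: "Measurable.pred M (P m)" for m
    unfolding P_def pred_def by (intro sets.sets_Collect_countable_Ex' cnt) measurable
  have "?X -` B \<inter> space M = {\<omega> \<in> space M. P k \<omega> \<and> \<not> P (Suc k) \<omega>}"
    using P lf by (auto simp: B)
  also have "\<dots> \<in> sets M"
    by measurable
  finally show "?X -` B \<inter> space M \<in> sets M" .
qed (use lf in auto)

section \<open>Criteria for independence and facts on uniform variables\<close>

context prob_space
begin

text \<open>For countably many values it suffices to treat single values, since every event is a
  countable union of those. The empty set joins the generators because the events of two different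
  values meet in it, which gives stability under intersection.\<close>

lemma indep_vars_countableI:
  fixes X :: "'i \<Rightarrow> 'a \<Rightarrow> 'b::countable"
  assumes meas: "\<And>i. i \<in> I \<Longrightarrow> X i \<in> M \<rightarrow>\<^sub>M count_space UNIV"
    and prod: "\<And>J k. finite J \<Longrightarrow> J \<noteq> {} \<Longrightarrow> J \<subseteq> I \<Longrightarrow>
      prob {\<omega> \<in> space M. \<forall>i\<in>J. X i \<omega> = k i} = (\<Prod>i\<in>J. prob {\<omega> \<in> space M. X i \<omega> = k i})"
  shows "indep_vars (\<lambda>_. count_space UNIV) X I"
proof -
  let ?E = "\<lambda>i k. {\<omega> \<in> space M. X i \<omega> = k}"
  let ?G = "\<lambda>i. insert {} (range (?E i))"
  have ev: "?E i k \<in> events" if "i \<in> I" for i k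
    using measurable_sets[OF meas[OF that], of "{k}"] by (simp add: vimage_def Int_def conj_commute)
  have "indep_sets ?G I"
  proof (rule indep_setsI)
    show "?G i \<subseteq> events" if "i \<in> I" for i
      using ev[OF that] by auto
    fix A J assume J: "J \<noteq> {}" "J \<subseteq> I" "finite J" "\<forall>j\<in>J. A j \<in> ?G j"
    show "prob (\<Inter>j\<in>J. A j) = (\<Prod>j\<in>J. prob (A j))"
    proof (cases "\<exists>j\<in>J. A j = {}")
      case True
      then obtain j where j: "j \<in> J" "A j = {}" by blast
      then have "(\<Prod>j\<in>J. prob (A j)) = 0"
        by (intro prod_zero J(3) bexI[of _ j]) auto
      moreover from j have "(\<Inter>j\<in>J. A j) = {}" by blast
      ultimately show ?thesis
        by (simp only: measure_empty)
    next
      case False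
      then have "\<forall>j\<in>J. \<exists>k. A j = ?E j k"
        using J(4) by blast
      then obtain k where k: "\<And>j. j \<in> J \<Longrightarrow> A j = ?E j (k j)"
        by metis
      then have "(\<Inter>j\<in>J. A j) = {\<omega> \<in> space M. \<forall>i\<in>J. X i \<omega> = k i}"
        using J(1) by auto
      then show ?thesis
        using prod[OF J(3,1,2), of k] k by simp
    qed
  qed
  then have "indep_sets (\<lambda>i. sigma_sets (space M) (?G i)) I"
    by (rule indep_sets_sigma) (auto simp: Int_stable_def)
  moreover have "{X i -` A \<inter> space M | A. A \<in> sets (count_space UNIV)} \<subseteq> sigma_sets (space M) (?G i)" for i
  proof safe
    fix A :: "'b set"
    interpret S: sigma_algebra "space M" "sigma_sets (space M) (?G i)"
      by (rule sigma_algebra_sigma_sets) auto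
    have "X i -` A \<inter> space M = (\<Union>k\<in>A. ?E i k)" by auto
    also have "\<dots> \<in> sigma_sets (space M) (?G i)"
      by (intro S.countable_UN') (auto intro: sigma_sets.Basic)
    finally show "X i -` A \<inter> space M \<in> sigma_sets (space M) (?G i)" .
  qed
  ultimately have "indep_sets (\<lambda>i. {X i -` A \<inter> space M | A. A \<in> sets (count_space UNIV)}) I"
    by (rule indep_sets_mono_sets)
  then show ?thesis
    unfolding indep_vars_def2 using meas by simp
qed

lemma indep_vars_reindex_inj:
  assumes X: "indep_vars (\<lambda>_. N) X UNIV" and e: "inj e"
  shows "indep_vars (\<lambda>_. N) (\<lambda>i. X (e i)) UNIV"
proof -
  have "indep_vars (\<lambda>i. PiM {e i} (\<lambda>_. N)) (\<lambda>i \<omega>. restrict (\<lambda>j. X j \<omega>) {e i}) UNIV"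
    by (rule indep_vars_restrict[OF X]) (auto simp: disjoint_family_on_def injD[OF e])
  then have "indep_vars (\<lambda>_. N) (\<lambda>i \<omega>. restrict (\<lambda>j. X j \<omega>) {e i} (e i)) UNIV"
    by (rule indep_vars_compose2[where Y = "\<lambda>i g. g (e i)"]) (rule measurable_component_singleton, simp)
  then show ?thesis by simp
qed

lemma indep_vars_imp_indep_var:
  assumes X: "indep_vars (\<lambda>_. N) X UNIV" and "i \<noteq> j"
  shows "indep_var N (X i) N (X j)"
proof -
  have "inj (case_bool i j)"
    using assms(2) by (auto simp: inj_def split: bool.splits)
  from indep_vars_reindex_inj[OF X this]
  have "indep_vars (\<lambda>_. N) (\<lambda>b. X (case_bool i j b)) UNIV" .
  then show ?thesis
    unfolding indep_var_def
    by (rule indep_vars_cong[THEN iffD1, rotated -1]) (auto split: bool.splits)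
qed

text \<open>The null endpoint 1 is dropped here: half-open cells tile the line, and
  \<open>poisson_quantile\<close> is characterised only below 1.\<close>

lemma uniform01_integral:
  fixes g :: "real \<Rightarrow> real"
  assumes U: "uniform01 U" and [measurable]: "g \<in> borel_measurable borel"
  shows "expectation (\<lambda>\<omega>. g (U \<omega>)) = (\<integral>u. indicator {0..<1} u * g u \<partial>lborel)"
proof -
  have "expectation (\<lambda>\<omega>. g (U \<omega>)) = (\<integral>u. indicator {0..1} u / measure lborel {0..1::real} * g u \<partial>lborel)"
    by (rule distributed_integral[OF U, symmetric]) auto
  also have "\<dots> = (\<integral>u. indicator {0..<1} u * g u \<partial>lborel)"
  proof (rule integral_cong_AE)
    show "AE u in lborel. indicator {0..1} u / measure lborel {0..1::real} * g u = indicator {0..<1} u * g u"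
      using AE_lborel_singleton[of "1::real"] by eventually_elim (auto simp: indicator_def)
  qed auto
  finally show ?thesis .
qed

text \<open>Fubini: for a fixed value of the first variable, the second almost surely avoids the
  single point that would give equality.\<close>

lemma uniform01_AE_distinct:
  assumes U: "uniform01 U" and W: "uniform01 W" and ind: "indep_var borel U borel W"
  shows "AE \<omega> in M. a + U \<omega> \<noteq> b + W \<omega>"
proof -
  have [measurable]: "U \<in> borel_measurable M" "W \<in> borel_measurable M"
    using indep_var_rv1[OF ind] indep_var_rv2[OF ind] by auto
  interpret A: prob_space "distr M borel U" by (rule prob_space_distr) simp
  interpret B: prob_space "distr M borel W" by (rule prob_space_distr) simp
  interpret P: pair_sigma_finite "distr M borel U" "distr M borel W" ..
  have W0: "AE y in distr M borel W. y \<noteq> c" for c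
  proof -
    have "distr M borel W = distr M lborel W"
      by (rule distr_cong) auto
    also have "\<dots> = density lborel (\<lambda>x. indicator {0..1} x / measure lborel {0..1::real})"
      using W by (simp add: distributed_def)
    finally have eq: "distr M borel W = density lborel (\<lambda>x. indicator {0..1} x / measure lborel {0..1::real})" .
    show ?thesis
      unfolding eq using AE_lborel_singleton[of c] by (subst AE_density) auto
  qed
  have "AE z in distr M borel U \<Otimes>\<^sub>M distr M borel W. a + fst z \<noteq> b + snd z"
  proof (rule P.AE_pair_measure)
    show "{z \<in> space (distr M borel U \<Otimes>\<^sub>M distr M borel W). a + fst z \<noteq> b + snd z}
        \<in> sets (distr M borel U \<Otimes>\<^sub>M distr M borel W)"
      by measurable
    have "AE y in distr M borel W. a + fst (x, y) \<noteq> b + snd (x, y)" for x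
      using W0[of "a + x - b"] by eventually_elim auto
    then show "AE x in distr M borel U. AE y in distr M borel W. a + fst (x, y) \<noteq> b + snd (x, y)"
      by simp
  qed
  moreover have "distr M borel U \<Otimes>\<^sub>M distr M borel W = distr M (borel \<Otimes>\<^sub>M borel) (\<lambda>\<omega>. (U \<omega>, W \<omega>))"
    using ind unfolding indep_var_distribution_eq by blast
  ultimately have "AE z in distr M (borel \<Otimes>\<^sub>M borel) (\<lambda>\<omega>. (U \<omega>, W \<omega>)). a + fst z \<noteq> b + snd z"
    by (simp only:)
  then show ?thesis
    by (subst (asm) AE_distr_iff) auto
qed

end

text \<open>Letting \<open>z\<close> tend to 0 gives \<open>d 0 = 0\<close>, and dividing by
  \<open>z\<close> then shifts the series. The hypothesis leaves out \<open>z = 0\<close> so that it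
  survives this division.\<close>

lemma powser_eq_zero_imp_coeff_zero:
  fixes d :: "nat \<Rightarrow> real"
  assumes "\<And>z. z \<noteq> 0 \<Longrightarrow> \<bar>z\<bar> < 1 \<Longrightarrow> (\<lambda>n. d n * z ^ n) sums 0"
  shows "d k = 0"
  using assms
proof (induction k arbitrary: d)
  case (0 d)
  have "((\<lambda>_::real. 0) \<longlongrightarrow> d 0) (at 0)"
    by (rule powser_limit_0_strong[of 1]) (use 0 in auto)
  then show ?case
    using LIM_unique tendsto_const by blast
next
  case (Suc k d)
  have "((\<lambda>_::real. 0) \<longlongrightarrow> d 0) (at 0)"
    by (rule powser_limit_0_strong[of 1]) (use Suc.prems in auto)
  then have d0: "d 0 = 0"
    using LIM_unique tendsto_const by blast
  have "(\<lambda>n. d (Suc n) * z ^ n) sums 0" if z: "z \<noteq> 0" "\<bar>z\<bar> < 1" for z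
  proof -
    have "(\<lambda>n. d (Suc n) * z ^ Suc n) sums 0"
      using Suc.prems[OF z] d0 by (subst sums_Suc_iff) simp
    then have "(\<lambda>n. (1 / z) * (d (Suc n) * z ^ Suc n)) sums ((1 / z) * 0)"
      by (rule sums_mult)
    then show ?thesis
      using z by simp
  qed
  then show ?case
    by (rule Suc.IH[of "\<lambda>n. d (Suc n)"])
qed

abbreviation poisson_weight :: "real \<Rightarrow> nat \<Rightarrow> real" where
  "poisson_weight \<mu> k \<equiv> \<mu> ^ k / fact k * exp (- \<mu>)"

lemma poisson_weight_pgf: "(\<lambda>k. poisson_weight \<mu> k * z ^ k) sums exp (\<mu> * (z - 1))"
proof -
  have "(\<lambda>k. exp (-\<mu>) * ((\<mu> * z) ^ k /\<^sub>R fact k)) sums (exp (-\<mu>) * exp (\<mu> * z))"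
    by (intro sums_mult exp_converges)
  also have "exp (-\<mu>) * exp (\<mu> * z) = exp (\<mu> * (z - 1))"
    by (simp add: exp_add[symmetric] algebra_simps)
  finally show ?thesis
    by (simp add: power_mult_distrib field_simps)
qed

section \<open>Poisson laws identified by their generating functions\<close>

context prob_space
begin

text \<open>The expectation is expanded over the values of \<open>c\<close>, with domination by the
  geometric series in \<open>\<bar>z\<bar>\<close>. The weight \<open>G\<close> leaves room for the
  other coordinates of a joint law.\<close>

lemma sums_expectation_power:
  fixes G :: "'a \<Rightarrow> real" and c :: "'a \<Rightarrow> nat"
  assumes [measurable]: "G \<in> borel_measurable M" "c \<in> M \<rightarrow>\<^sub>M count_space UNIV"
    and G: "\<And>\<omega>. \<bar>G \<omega>\<bar> \<le> 1" and z: "\<bar>z\<bar> < 1"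
  shows "(\<lambda>k. expectation (\<lambda>\<omega>. G \<omega> * of_bool (c \<omega> = k)) * z ^ k) sums expectation (\<lambda>\<omega>. G \<omega> * z ^ c \<omega>)"
proof -
  define f where "f k \<omega> = G \<omega> * of_bool (c \<omega> = k) * z ^ k" for k \<omega>
  have [measurable]: "f k \<in> borel_measurable M" for k
    unfolding f_def by measurable
  have bound: "norm (f k \<omega>) \<le> \<bar>z\<bar> ^ k" for k \<omega>
    using mult_mono[of "\<bar>G \<omega>\<bar>" 1 "\<bar>z\<bar> ^ k" "\<bar>z\<bar> ^ k"] G[of \<omega>] by (auto simp: f_def abs_mult power_abs)
  have int: "integrable M (f k)" for k
    by (rule integrable_const_bound[of _ "\<bar>z\<bar> ^ k"]) (use bound in auto)
  have sm: "summable (\<lambda>k. \<bar>z\<bar> ^ k)"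
    using z by (intro summable_geometric) simp
  have "(\<lambda>k. expectation (f k)) sums expectation (\<lambda>\<omega>. \<Sum>k. f k \<omega>)"
  proof (rule sums_integral)
    show "AE \<omega> in M. summable (\<lambda>k. norm (f k \<omega>))"
      using bound by (intro AE_I2 summable_comparison_test'[OF sm]) simp
    have "(\<integral>\<omega>. norm (f k \<omega>) \<partial>M) \<le> \<bar>z\<bar> ^ k" for k
      using integral_le_const[of "\<lambda>\<omega>. norm (f k \<omega>)" "\<bar>z\<bar> ^ k"] int bound by simp
    then show "summable (\<lambda>k. \<integral>\<omega>. norm (f k \<omega>) \<partial>M)"
      by (intro summable_comparison_test'[OF sm]) simp
  qed (rule int)
  moreover have "(\<Sum>k. f k \<omega>) = G \<omega> * z ^ c \<omega>" for \<omega>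
    by (subst suminf_finite[of "{c \<omega>}"]) (auto simp: f_def)
  moreover have "expectation (f k) = expectation (\<lambda>\<omega>. G \<omega> * of_bool (c \<omega> = k)) * z ^ k" for k
    unfolding f_def by (rule integral_mult_left_zero)
  ultimately show ?thesis
    by (simp only:)
qed

lemma poisson_pgf_unique:
  fixes G :: "'a \<Rightarrow> real" and c :: "'a \<Rightarrow> nat"
  assumes [measurable]: "G \<in> borel_measurable M" "c \<in> M \<rightarrow>\<^sub>M count_space UNIV"
    and G: "\<And>\<omega>. \<bar>G \<omega>\<bar> \<le> 1"
    and pgf: "\<And>z. \<bar>z\<bar> < 1 \<Longrightarrow> expectation (\<lambda>\<omega>. G \<omega> * z ^ c \<omega>) = C * exp (\<mu> * (z - 1))"
  shows "expectation (\<lambda>\<omega>. G \<omega> * of_bool (c \<omega> = k)) = C * poisson_weight \<mu> k"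
proof -
  have "expectation (\<lambda>\<omega>. G \<omega> * of_bool (c \<omega> = k)) - C * poisson_weight \<mu> k = 0"
  proof (rule powser_eq_zero_imp_coeff_zero[of "\<lambda>k. expectation (\<lambda>\<omega>. G \<omega> * of_bool (c \<omega> = k)) - C * poisson_weight \<mu> k"])
    fix z :: real assume z: "\<bar>z\<bar> < 1"
    show "(\<lambda>k. (expectation (\<lambda>\<omega>. G \<omega> * of_bool (c \<omega> = k)) - C * poisson_weight \<mu> k) * z ^ k) sums 0"
      using sums_diff[OF sums_expectation_power[OF assms(1,2) G z] sums_mult[OF poisson_weight_pgf[of \<mu> z], of C]]
        pgf[OF z] by (simp add: algebra_simps)
  qed
  then show ?thesis by simp
qed

text \<open>Coordinates are converted one at a time, \<open>K\<close> being the set of those already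
  done. With the other \<open>z i\<close> frozen, the formula is a power series in
  \<open>z j\<close>, and comparing coefficients replaces the factor
  \<open>z j ^ c j \<omega>\<close> by the indicator of \<open>c j \<omega> = k j\<close>.\<close>

lemma joint_poisson_pgf_unique:
  fixes c :: "'i \<Rightarrow> 'a \<Rightarrow> nat"
  assumes J: "finite J" and c: "\<And>i. i \<in> J \<Longrightarrow> c i \<in> M \<rightarrow>\<^sub>M count_space UNIV"
    and pgf: "\<And>z. (\<And>i. \<bar>z i\<bar> < 1) \<Longrightarrow>
      expectation (\<lambda>\<omega>. \<Prod>i\<in>J. z i ^ c i \<omega>) = (\<Prod>i\<in>J. exp (\<mu> i * (z i - 1)))"
  shows "prob {\<omega> \<in> space M. \<forall>i\<in>J. c i \<omega> = k i} = (\<Prod>i\<in>J. poisson_weight (\<mu> i) (k i))"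
proof -
  have mixed: "expectation (\<lambda>\<omega>. (\<Prod>i\<in>K. of_bool (c i \<omega> = k i)) * (\<Prod>i\<in>J - K. z i ^ c i \<omega>)) =
      (\<Prod>i\<in>K. poisson_weight (\<mu> i) (k i)) * (\<Prod>i\<in>J - K. exp (\<mu> i * (z i - 1)))"
    if "finite K" "K \<subseteq> J" "\<And>i. \<bar>z i\<bar> < 1" for K z
    using that
  proof (induction K arbitrary: z)
    case empty
    then show ?case using pgf[of z] by simp
  next
    case (insert j K)
    have sub: "K \<subseteq> J" "j \<in> J" "j \<notin> K" and fin: "finite K" "finite (J - insert j K)"
      using insert J by auto
    have JK: "J - K = insert j (J - insert j K)"
      using sub by auto
    define G where "G \<omega> = (\<Prod>i\<in>K. of_bool (c i \<omega> = k i)) * (\<Prod>i\<in>J - insert j K. z i ^ c i \<omega>)" for \<omega>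
    have mG: "G \<in> borel_measurable M"
      unfolding G_def
    proof (intro borel_measurable_times borel_measurable_prod)
      show "(\<lambda>\<omega>. of_bool (c i \<omega> = k i)) \<in> borel_measurable M" if "i \<in> K" for i
        using that sub by (intro measurable_compose[OF c]) auto
      show "(\<lambda>\<omega>. z i ^ c i \<omega>) \<in> borel_measurable M" if "i \<in> J - insert j K" for i
        using that by (intro measurable_compose[OF c]) auto
    qed
    have "\<bar>z i\<bar> ^ n \<le> 1" for i n
      using insert.prems(2)[of i] by (intro power_le_one) auto
    then have G1: "\<bar>G \<omega>\<bar> \<le> 1" for \<omega>
      unfolding G_def abs_mult abs_prod
      by (intro mult_le_one prod_le_1 prod_nonneg) (auto simp: power_abs)
    have eq: "expectation (\<lambda>\<omega>. G \<omega> * x ^ c j \<omega>) =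
       ((\<Prod>i\<in>K. poisson_weight (\<mu> i) (k i)) * (\<Prod>i\<in>J - insert j K. exp (\<mu> i * (z i - 1)))) * exp (\<mu> j * (x - 1))"
      if "\<bar>x\<bar> < 1" for x
    proof -
      have up: "(\<Prod>i\<in>J - insert j K. g i ((z(j := x)) i)) = (\<Prod>i\<in>J - insert j K. g i (z i))"
        for g :: "'i \<Rightarrow> real \<Rightarrow> real"
        by (rule prod.cong) auto
      have "expectation (\<lambda>\<omega>. (\<Prod>i\<in>K. of_bool (c i \<omega> = k i)) * (\<Prod>i\<in>J - K. (z(j := x)) i ^ c i \<omega>)) =
        (\<Prod>i\<in>K. poisson_weight (\<mu> i) (k i)) * (\<Prod>i\<in>J - K. exp (\<mu> i * ((z(j := x)) i - 1)))"
        using insert.prems(2) that by (intro insert.IH sub) auto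
      moreover have "(\<Prod>i\<in>J - K. (z(j := x)) i ^ c i \<omega>) = x ^ c j \<omega> * (\<Prod>i\<in>J - insert j K. z i ^ c i \<omega>)" for \<omega>
        unfolding JK using fin up[of "\<lambda>i y. y ^ c i \<omega>"] by (subst prod.insert) auto
      moreover have "(\<Prod>i\<in>J - K. exp (\<mu> i * ((z(j := x)) i - 1))) =
          exp (\<mu> j * (x - 1)) * (\<Prod>i\<in>J - insert j K. exp (\<mu> i * (z i - 1)))"
        unfolding JK using fin up[of "\<lambda>i y. exp (\<mu> i * (y - 1))"] by (subst prod.insert) auto
      ultimately show ?thesis
        by (simp add: G_def ac_simps)
    qed
    show ?case
      using poisson_pgf_unique[OF mG c[OF sub(2)] G1 eq, of "k j"] sub fin
      by (simp add: G_def ac_simps)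
  qed
  have "prob {\<omega> \<in> space M. \<forall>i\<in>J. c i \<omega> = k i} = expectation (indicator {\<omega> \<in> space M. \<forall>i\<in>J. c i \<omega> = k i})"
    by (simp add: Int_def conj_commute)
  also have "\<dots> = expectation (\<lambda>\<omega>. \<Prod>i\<in>J. of_bool (c i \<omega> = k i))"
    by (rule Bochner_Integration.integral_cong[OF refl]) (auto simp: indicator_def J prod_zero_iff)
  also have "\<dots> = (\<Prod>i\<in>J. poisson_weight (\<mu> i) (k i))"
    using mixed[of J "\<lambda>_. 0"] J by simp
  finally show ?thesis .
qed

end

section \<open>Construction of a Poisson process\<close>

text \<open>Generalised inverse of the Poisson distribution function; the strict inequality yields
  half-open intervals of length \<open>poisson_weight \<mu> k\<close>. For
  \<open>0 \<le> \<mu>\<close> the partial sums are at most 1, so at \<open>u = 1\<close> the value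
  is unspecified. It is still a natural number, so every cell receives finitely many points at every
  outcome.\<close>

definition poisson_quantile :: "real \<Rightarrow> real \<Rightarrow> nat" where
  "poisson_quantile \<mu> u = (LEAST k. u < (\<Sum>i<Suc k. poisson_weight \<mu> i))"

lemma measurable_poisson_quantile [measurable]:
  "poisson_quantile \<mu> \<in> borel \<rightarrow>\<^sub>M count_space UNIV"
  unfolding poisson_quantile_def by measurable

lemma poisson_quantile_eq_iff:
  assumes "\<mu> \<ge> 0" "0 \<le> u" "u < 1"
  shows "poisson_quantile \<mu> u = k \<longleftrightarrow> u \<in> {(\<Sum>i<k. poisson_weight \<mu> i)..<(\<Sum>i<Suc k. poisson_weight \<mu> i)}"
proof -
  define S where "S k = (\<Sum>i<k. poisson_weight \<mu> i)" for k
  have "S \<longlonglongrightarrow> 1"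
    using poisson_weight_pgf[of \<mu> 1] by (simp add: sums_def S_def[abs_def])
  then have "eventually (\<lambda>k. u < S k) sequentially"
    using order_tendstoD(1) assms(3) by blast
  then obtain N where "\<And>k. k \<ge> N \<Longrightarrow> u < S k"
    unfolding eventually_sequentially by blast
  then have ex: "u < S (Suc N)" by simp
  have mono: "S k \<le> S l" if "k \<le> l" for k l
    unfolding S_def using that assms(1) by (intro sum_mono2) auto
  have S0: "S 0 = 0" by (simp add: S_def)
  show ?thesis
    unfolding poisson_quantile_def S_def[symmetric]
  proof
    assume k: "(LEAST k. u < S (Suc k)) = k"
    have "u < S (Suc k)"
      using LeastI[of "\<lambda>k. u < S (Suc k)", OF ex] k by simp
    moreover have "S k \<le> u"
    proof (cases k)
      case 0 then show ?thesis using S0 assms by simp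
    next
      case (Suc l)
      then show ?thesis
        using not_less_Least[of l "\<lambda>k. u < S (Suc k)"] k by simp
    qed
    ultimately show "u \<in> {S k..<S (Suc k)}" by simp
  next
    assume u: "u \<in> {S k..<S (Suc k)}"
    show "(LEAST k. u < S (Suc k)) = k"
    proof (rule Least_equality)
      fix l assume "u < S (Suc l)"
      then show "k \<le> l"
        using u mono[of "Suc l" k] by (cases "k \<le> l") auto
    qed (use u in auto)
  qed
qed

section \<open>One cell: a Poisson number of independent uniform points\<close>

context prob_space
begin

lemma expectation_poisson_quantile:
  assumes U: "uniform01 U" and "\<mu> \<ge> 0"
  shows "expectation (\<lambda>\<omega>. of_bool (poisson_quantile \<mu> (U \<omega>) = k)) = poisson_weight \<mu> k"
proof -
  define S where "S k = (\<Sum>i<k. poisson_weight \<mu> i)" for k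
  have S: "0 \<le> S k" "S k \<le> 1" for k
  proof -
    have "summable (poisson_weight \<mu>)" "suminf (poisson_weight \<mu>) = 1"
      using poisson_weight_pgf[of \<mu> 1] by (auto simp: sums_iff)
    then show "S k \<le> 1"
      unfolding S_def using sum_le_suminf[of "poisson_weight \<mu>" "{..<k}"] assms(2) by auto
    show "0 \<le> S k"
      unfolding S_def using assms(2) by (intro sum_nonneg) auto
  qed
  have q: "poisson_quantile \<mu> u = k \<longleftrightarrow> u \<in> {S k..<S (Suc k)}" if "0 \<le> u" "u < 1" for u
    unfolding S_def by (rule poisson_quantile_eq_iff[OF assms(2) that])
  have diff: "S (Suc k) - S k = poisson_weight \<mu> k"
    by (simp add: S_def)
  have w: "poisson_weight \<mu> k \<ge> 0"
    using assms(2) by simp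
  have "expectation (\<lambda>\<omega>. of_bool (poisson_quantile \<mu> (U \<omega>) = k)) =
      (\<integral>u. indicator {0..<1} u * of_bool (poisson_quantile \<mu> u = k) \<partial>lborel :: real)"
    by (rule uniform01_integral[OF U]) measurable
  also have "\<dots> = (\<integral>u. indicator {S k..<S (Suc k)} u \<partial>lborel)"
  proof (rule Bochner_Integration.integral_cong[OF refl])
    fix u :: real
    show "indicator {0..<1} u * of_bool (poisson_quantile \<mu> u = k) = (indicator {S k..<S (Suc k)} u :: real)"
      using q[of u] S(1)[of k] S(2)[of "Suc k"] by (auto simp: indicator_def)
  qed
  also have "\<dots> = poisson_weight \<mu> k"
    using diff w by simp
  finally show ?thesis .
qed

text \<open>For \<open>k\<close> points, independence yields the \<open>k\<close>-th power of the
  mean of \<open>h (t + u)\<close> over \<open>0 \<le> u < 1\<close>; summing over \<open>k\<close>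
  with the Poisson weights evaluates the Poisson generating function at this mean.\<close>

lemma expectation_poisson_cell:
  fixes U :: "nat \<Rightarrow> 'a \<Rightarrow> real" and h :: "real \<Rightarrow> real"
  assumes ind: "indep_vars (\<lambda>_. borel) U UNIV" and U: "\<And>j. uniform01 (U j)" and "\<mu> \<ge> 0"
    and h[measurable]: "h \<in> borel_measurable borel" and h1: "\<And>x. \<bar>h x\<bar> \<le> 1"
  shows "expectation (\<lambda>\<omega>. \<Prod>j<poisson_quantile \<mu> (U 0 \<omega>). h (t + U (Suc j) \<omega>)) =
    exp (\<mu> * ((\<integral>u. indicator {0..<1} u * h (t + u) \<partial>lborel) - 1))"
proof -
  let ?m = "\<integral>u. indicator {0..<1} u * h (t + u) \<partial>lborel"
  have [measurable]: "U j \<in> borel_measurable M" for j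
    using ind by (auto simp: indep_vars_def)
  define f where "f k \<omega> = of_bool (poisson_quantile \<mu> (U 0 \<omega>) = k) * (\<Prod>j<k. h (t + U (Suc j) \<omega>))" for k \<omega>
  have mf[measurable]: "f k \<in> borel_measurable M" for k
    unfolding f_def by measurable
  have norm_f: "norm (f k \<omega>) \<le> of_bool (poisson_quantile \<mu> (U 0 \<omega>) = k)" for k \<omega>
    using h1 by (auto simp: f_def abs_prod intro!: prod_le_1)
  have norm_f1: "norm (f k \<omega>) \<le> 1" for k \<omega>
    using norm_f[of k \<omega>] by (auto simp: of_bool_def split: if_splits)
  have int: "integrable M (f k)" for k
    by (rule integrable_const_bound[of _ 1]) (use norm_f1 in auto)
  have Ef: "expectation (f k) = poisson_weight \<mu> k * ?m ^ k" for k
  proof -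
    \<comment> \<open>Index 0 carries the event that the count is \<open>k\<close> and the positive
      indices carry the points, so one product over independent variables covers both.\<close>
    define Y :: "nat \<Rightarrow> real \<Rightarrow> real" where
      "Y j = (if j = 0 then (\<lambda>u. of_bool (poisson_quantile \<mu> u = k)) else (\<lambda>u. h (t + u)))" for j
    have mY[measurable]: "Y j \<in> borel_measurable borel" for j
      by (cases "j = 0") (simp_all add: Y_def)
    have Y1: "\<bar>Y j u\<bar> \<le> 1" for j u
      using h1 by (auto simp: Y_def)
    have "indep_vars (\<lambda>_. borel) (\<lambda>j \<omega>. Y j (U j \<omega>)) {..k}"
      by (rule indep_vars_compose2[OF indep_vars_subset[OF ind]]) auto
    then have E: "expectation (\<lambda>\<omega>. \<Prod>j\<le>k. Y j (U j \<omega>)) = (\<Prod>j\<le>k. expectation (\<lambda>\<omega>. Y j (U j \<omega>)))"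
      by (intro indep_vars_lebesgue_integral integrable_const_bound[of _ 1]) (use Y1 in auto)
    have Y0: "expectation (\<lambda>\<omega>. Y 0 (U 0 \<omega>)) = poisson_weight \<mu> k"
      using expectation_poisson_quantile[OF U assms(3), of 0 k] by (simp add: Y_def)
    have YSuc: "expectation (\<lambda>\<omega>. Y (Suc j) (U (Suc j) \<omega>)) = ?m" for j
      using uniform01_integral[OF U[of "Suc j"], of "\<lambda>u. h (t + u)"] by (simp add: Y_def)
    have "f k = (\<lambda>\<omega>. \<Prod>j\<le>k. Y j (U j \<omega>))"
      unfolding f_def[abs_def] prod.atMost_shift by (simp add: Y_def)
    then have "expectation (f k) = (\<Prod>j\<le>k. expectation (\<lambda>\<omega>. Y j (U j \<omega>)))"
      by (simp only: E)
    then show ?thesis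
      by (simp only: prod.atMost_shift Y0 YSuc prod_constant card_lessThan)
  qed
  have "(\<lambda>k. expectation (f k)) sums expectation (\<lambda>\<omega>. \<Sum>k. f k \<omega>)"
  proof (rule sums_integral)
    show "AE \<omega> in M. summable (\<lambda>k. norm (f k \<omega>))"
    proof (intro AE_I2)
      show "summable (\<lambda>k. norm (f k \<omega>))" for \<omega>
        by (rule summable_finite[of "{poisson_quantile \<mu> (U 0 \<omega>)}"]) (auto simp: f_def)
    qed
    have "(\<integral>\<omega>. norm (f k \<omega>) \<partial>M) \<le> expectation (\<lambda>\<omega>. of_bool (poisson_quantile \<mu> (U 0 \<omega>) = k))" for k
    proof (rule integral_mono[OF _ _ norm_f])
      show "integrable M (\<lambda>\<omega>. of_bool (poisson_quantile \<mu> (U 0 \<omega>) = k) :: real)"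
        by (rule integrable_const_bound[of _ 1]) auto
      show "integrable M (\<lambda>\<omega>. norm (f k \<omega>))"
        using int by (rule integrable_norm)
    qed
    then have le: "norm (\<integral>\<omega>. norm (f k \<omega>) \<partial>M) \<le> poisson_weight \<mu> k" for k
      unfolding expectation_poisson_quantile[OF U[of 0] assms(3)] by simp
    show "summable (\<lambda>k. \<integral>\<omega>. norm (f k \<omega>) \<partial>M)"
      by (rule summable_comparison_test'[OF sums_summable[OF poisson_weight_pgf[of \<mu> 1]], of 0])
        (simp only: power_one mult_1_right le)
  qed (rule int)
  moreover have "(\<Sum>k. f k \<omega>) = (\<Prod>j<poisson_quantile \<mu> (U 0 \<omega>). h (t + U (Suc j) \<omega>))" for \<omega>
    by (subst suminf_finite[of "{poisson_quantile \<mu> (U 0 \<omega>)}" "\<lambda>k. f k \<omega>"]) (auto simp: f_def)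
  ultimately have "(\<lambda>k. poisson_weight \<mu> k * ?m ^ k) sums
      expectation (\<lambda>\<omega>. \<Prod>j<poisson_quantile \<mu> (U 0 \<omega>). h (t + U (Suc j) \<omega>))"
    by (simp only: Ef)
  then show ?thesis
    by (rule sums_unique2) (rule poisson_weight_pgf)
qed

end

text \<open>
  \<open>U (n, 0)\<close> decides the number of points in the \<open>n\<close>-th unit cell, and \<open>U (n, Suc j)\<close> the position
  of the \<open>j\<close>-th of them.
\<close>

definition uniform_points :: "real \<Rightarrow> (int \<times> nat \<Rightarrow> 'a \<Rightarrow> real) \<Rightarrow> 'a \<Rightarrow> real set" where
  "uniform_points \<mu> U \<omega> =
     {real_of_int (fst i) + U (fst i, Suc (snd i)) \<omega> | i. snd i < poisson_quantile \<mu> (U (fst i, 0) \<omega>)}"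

lemma locally_finite_uniform_points:
  assumes "\<And>i. U i \<omega> \<in> {0..1}"
  shows "uniform_points \<mu> U \<omega> \<in> locally_finite_sets"
proof -
  have "finite (uniform_points \<mu> U \<omega> \<inter> {a..b})" for a b
  proof (rule finite_subset)
    \<comment> \<open>A point of cell \<open>n\<close> lies between \<open>n\<close> and
      \<open>n + 1\<close>, so it may reach \<open>a\<close> as soon as
      \<open>n \<ge> a - 1\<close>; hence the extra cell on the left.\<close>
    show "uniform_points \<mu> U \<omega> \<inter> {a..b} \<subseteq> (\<lambda>i. real_of_int (fst i) + U (fst i, Suc (snd i)) \<omega>) `
        Sigma {\<lfloor>a\<rfloor> - 1..\<lceil>b\<rceil>} (\<lambda>n. {..<poisson_quantile \<mu> (U (n, 0) \<omega>)})"
    proof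
      fix x assume "x \<in> uniform_points \<mu> U \<omega> \<inter> {a..b}"
      then obtain n j where x: "x = real_of_int n + U (n, Suc j) \<omega>" "j < poisson_quantile \<mu> (U (n, 0) \<omega>)"
        and ab: "a \<le> x" "x \<le> b"
        by (auto simp: uniform_points_def)
      have "n \<in> {\<lfloor>a\<rfloor> - 1..\<lceil>b\<rceil>}"
        using assms[of "(n, Suc j)"] ab x(1) by (auto; linarith)
      then show "x \<in> (\<lambda>i. real_of_int (fst i) + U (fst i, Suc (snd i)) \<omega>) `
          Sigma {\<lfloor>a\<rfloor> - 1..\<lceil>b\<rceil>} (\<lambda>n. {..<poisson_quantile \<mu> (U (n, 0) \<omega>)})"
        using x by (intro image_eqI[of _ _ "(n, j)"]) auto
    qed
  qed auto
  then show ?thesis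
    by (auto simp: locally_finite_sets_def)
qed

lemma measurable_uniform_points:
  assumes [measurable]: "\<And>i. U i \<in> borel_measurable M" and "\<And>i \<omega>. \<omega> \<in> space M \<Longrightarrow> U i \<omega> \<in> {0..1}"
  shows "uniform_points \<mu> U \<in> M \<rightarrow>\<^sub>M point_configurations"
proof -
  have eq: "uniform_points \<mu> U = (\<lambda>\<omega>. {real_of_int (fst i) + U (fst i, Suc (snd i)) \<omega> | i.
      snd i < poisson_quantile \<mu> (U (fst i, 0) \<omega>)})"
    by (simp add: uniform_points_def fun_eq_iff)
  show ?thesis
    unfolding eq
    by (rule measurable_point_set, measurable)
      (use locally_finite_uniform_points[of U] assms(2) in \<open>simp add: uniform_points_def\<close>)
qed

lemma measurable_card_Int:
  assumes "A \<in> sets borel" "bounded A"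
  shows "(\<lambda>S. card (S \<inter> A)) \<in> point_configurations \<rightarrow>\<^sub>M count_space UNIV"
  unfolding measurable_count_space_eq2_countable
  using sets_point_configurations_card[OF assms]
  by (auto simp: vimage_def Int_def conj_commute)

text \<open>Counting indices instead of points lets the count split over the cells; injectivity
  ensures that no point is counted twice. The range starts at \<open>a - 1\<close> because
  \<open>U\<close> may take the value 1.\<close>

lemma uniform_points_card_Int:
  fixes U :: "int \<times> nat \<Rightarrow> 'a \<Rightarrow> real"
  defines "V \<equiv> \<lambda>i \<omega>. real_of_int (fst i) + U (fst i, Suc (snd i)) \<omega>"
  assumes U: "\<And>i. U i \<omega> \<in> {0..1}" and inj: "inj (\<lambda>i. V i \<omega>)"
    and A: "\<And>x. x \<in> A \<Longrightarrow> x \<in> {real_of_int a..real_of_int b}"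
  shows "card (uniform_points \<mu> U \<omega> \<inter> A) =
    card {i \<in> Sigma {a - 1..b} (\<lambda>n. {..<poisson_quantile \<mu> (U (n, 0) \<omega>)}). V i \<omega> \<in> A}"
proof -
  have "uniform_points \<mu> U \<omega> \<inter> A =
    (\<lambda>i. V i \<omega>) ` {i \<in> Sigma {a - 1..b} (\<lambda>n. {..<poisson_quantile \<mu> (U (n, 0) \<omega>)}). V i \<omega> \<in> A}" (is "?l = ?r")
  proof
    show "?r \<subseteq> ?l"
      by (auto simp: uniform_points_def V_def) blast
    show "?l \<subseteq> ?r"
    proof
      fix x assume x: "x \<in> ?l"
      then obtain n j where n: "x = V (n, j) \<omega>" "j < poisson_quantile \<mu> (U (n, 0) \<omega>)"
        by (auto simp: uniform_points_def V_def)
      have "real_of_int a \<le> x" "x \<le> real_of_int b"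
        using A x by auto
      then have "real_of_int (a - 1) \<le> real_of_int n" "real_of_int n \<le> real_of_int b"
        using U[of "(n, Suc j)"] n(1) by (auto simp: V_def)
      then have "n \<in> {a - 1..b}"
        by (simp only: of_int_le_iff atLeastAtMost_iff)
      moreover have "V (n, j) \<omega> \<in> A"
        using x n(1) by simp
      ultimately show "x \<in> ?r"
        using n by blast
    qed
  qed
  then show ?thesis
    using inj by (simp add: card_image inj_on_subset)
qed

text \<open>The product is the contribution of a single point to a joint generating function. As the
  sets are disjoint, at most one factor differs from 1, so it equals 1 plus the sum of the terms
  \<open>(z i - 1) * indicator (A i) x\<close>.\<close>

lemma integral_unit_cell:
  fixes z :: "'i \<Rightarrow> real"
  assumes J: "finite J" and A[measurable]: "\<And>i. i \<in> J \<Longrightarrow> A i \<in> sets borel" and disj: "disjoint_family_on A J"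
  shows "(\<integral>u. indicator {0..<1} u * (\<Prod>i\<in>J. if real_of_int n + u \<in> A i then z i else 1) \<partial>lborel) - 1 =
    (\<Sum>i\<in>J. (z i - 1) * measure lborel ({real_of_int n..<real_of_int n + 1} \<inter> A i))"
proof -
  have h: "(\<Prod>i\<in>J. if x \<in> A i then z i else 1) = 1 + (\<Sum>i\<in>J. (z i - 1) * indicator (A i) x)" for x
  proof (cases "\<exists>i\<in>J. x \<in> A i")
    case True
    then obtain i0 where i0: "i0 \<in> J" "x \<in> A i0" by blast
    then have "x \<in> A i \<longleftrightarrow> i = i0" if "i \<in> J" for i
      using disj that unfolding disjoint_family_on_def by blast
    then have "(\<Prod>i\<in>J. if x \<in> A i then z i else 1) = (\<Prod>i\<in>J. if i = i0 then z i else 1)"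
      "(\<Sum>i\<in>J. (z i - 1) * indicator (A i) x) = (\<Sum>i\<in>J. if i = i0 then z i - 1 else 0)"
      by (auto intro!: prod.cong sum.cong simp: indicator_def)
    then show ?thesis
      using i0 J by (simp add: prod.delta sum.delta)
  next
    case False
    then show ?thesis by (simp add: prod.neutral sum.neutral indicator_def)
  qed
  let ?I = "{real_of_int n..<real_of_int n + 1}"
  have int: "integrable lborel (\<lambda>u. indicator (?I \<inter> A i) (real_of_int n + u) :: real)"
    "(\<integral>u. indicator (?I \<inter> A i) (real_of_int n + u) \<partial>lborel) = measure lborel (?I \<inter> A i)" if i: "i \<in> J" for i
  proof -
    have "emeasure lborel (?I \<inter> A i) < \<infinity>"
      by (rule emeasure_bounded_finite) (rule bounded_subset[OF bounded_Ico], auto)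
    then have *: "integrable lborel (indicator (?I \<inter> A i) :: real \<Rightarrow> real)"
      using A[OF i] by (intro integrable_real_indicator) auto
    show "integrable lborel (\<lambda>u. indicator (?I \<inter> A i) (real_of_int n + u) :: real)"
      using lborel_integrable_real_affine[OF *, of 1 "real_of_int n"] by simp
    show "(\<integral>u. indicator (?I \<inter> A i) (real_of_int n + u) \<partial>lborel) = measure lborel (?I \<inter> A i)"
      using lborel_integral_real_affine[of 1 "indicator (?I \<inter> A i) :: real \<Rightarrow> real" "real_of_int n"] by simp
  qed
  have one: "integrable lborel (indicator {0..<1} :: real \<Rightarrow> real)"
    "(\<integral>u. indicator {0..<1::real} u \<partial>lborel) = (1::real)"
    by simp_all
  have "(\<lambda>u. indicator {0..<1} u * (\<Prod>i\<in>J. if real_of_int n + u \<in> A i then z i else 1)) =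
    (\<lambda>u. indicator {0..<1} u + (\<Sum>i\<in>J. (z i - 1) * indicator (?I \<inter> A i) (real_of_int n + u)))"
  proof
    fix u :: real
    show "indicator {0..<1} u * (\<Prod>i\<in>J. if real_of_int n + u \<in> A i then z i else 1) =
      indicator {0..<1} u + (\<Sum>i\<in>J. (z i - 1) * indicator (?I \<inter> A i) (real_of_int n + u))"
    proof (cases "u \<in> {0..<1}")
      case True
      then show ?thesis unfolding h by (auto simp: indicator_def)
    next
      case False
      then show ?thesis by (auto simp: indicator_def intro!: sum.neutral)
    qed
  qed
  then have "(\<integral>u. indicator {0..<1} u * (\<Prod>i\<in>J. if real_of_int n + u \<in> A i then z i else 1) \<partial>lborel) =
    (\<integral>u. indicator {0..<1} u + (\<Sum>i\<in>J. (z i - 1) * indicator (?I \<inter> A i) (real_of_int n + u)) \<partial>lborel)"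
    by (simp only:)
  also have "\<dots> = (\<integral>u. indicator {0..<1::real} u \<partial>lborel) +
      (\<integral>u. (\<Sum>i\<in>J. (z i - 1) * indicator (?I \<inter> A i) (real_of_int n + u)) \<partial>lborel)"
    by (intro Bochner_Integration.integral_add one Bochner_Integration.integrable_sum integrable_mult_right int)
  also have "(\<integral>u. (\<Sum>i\<in>J. (z i - 1) * indicator (?I \<inter> A i) (real_of_int n + u)) \<partial>lborel) =
      (\<Sum>i\<in>J. \<integral>u. (z i - 1) * indicator (?I \<inter> A i) (real_of_int n + u) \<partial>lborel)"
    by (intro Bochner_Integration.integral_sum integrable_mult_right int)
  also have "\<dots> = (\<Sum>i\<in>J. (z i - 1) * measure lborel (?I \<inter> A i))"
    using int by (intro sum.cong refl) simp
  finally show ?thesis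
    using one by simp
qed

text \<open>The cell \<open>a - 1\<close> misses \<open>A\<close> and is included so that the range
  agrees with that of \<open>uniform_points_card_Int\<close>; the cell \<open>b\<close> is there for
  the point \<open>b\<close> itself.\<close>

lemma measure_unit_cells:
  assumes [measurable]: "A \<in> sets borel" and A: "A \<subseteq> {real_of_int a..real_of_int b}"
  shows "(\<Sum>n\<in>{a - 1..b}. measure lborel ({real_of_int n..<real_of_int n + 1} \<inter> A)) = measure lborel A"
proof -
  have "measure lborel (\<Union>n\<in>{a - 1..b}. {real_of_int n..<real_of_int n + 1} \<inter> A) =
    (\<Sum>n\<in>{a - 1..b}. measure lborel ({real_of_int n..<real_of_int n + 1} \<inter> A))"
  proof (rule measure_finite_Union)
    show "disjoint_family_on (\<lambda>n. {real_of_int n..<real_of_int n + 1} \<inter> A) {a - 1..b}"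
      unfolding disjoint_family_on_def
    proof safe
      fix m n :: int and x assume "m \<noteq> n" "x \<in> {real_of_int m..<real_of_int m + 1}" "x \<in> {real_of_int n..<real_of_int n + 1}"
      then show "x \<in> {}"
        by (auto; linarith)
    qed
    show "emeasure lborel ({real_of_int n..<real_of_int n + 1} \<inter> A) \<noteq> \<infinity>" for n
    proof -
      have "bounded ({real_of_int n..<real_of_int n + 1} \<inter> A)"
        by (rule bounded_subset[OF bounded_Ico]) auto
      from emeasure_bounded_finite[OF this] show ?thesis by simp
    qed
  qed auto
  moreover have "(\<Union>n\<in>{a - 1..b}. {real_of_int n..<real_of_int n + 1} \<inter> A) = A"
  proof
    show "A \<subseteq> (\<Union>n\<in>{a - 1..b}. {real_of_int n..<real_of_int n + 1} \<inter> A)"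
    proof
      fix x assume x: "x \<in> A"
      then have "real_of_int a \<le> x" "x \<le> real_of_int b" using A by auto
      then have "\<lfloor>x\<rfloor> \<in> {a - 1..b}" by (auto; linarith)
      moreover have "x \<in> {real_of_int \<lfloor>x\<rfloor>..<real_of_int \<lfloor>x\<rfloor> + 1}" by simp
      ultimately show "x \<in> (\<Union>n\<in>{a - 1..b}. {real_of_int n..<real_of_int n + 1} \<inter> A)"
        using x by blast
    qed
  qed auto
  ultimately show ?thesis by simp
qed

section \<open>Joint generating function of the counts\<close>

context prob_space
begin

lemma AE_uniform_points_inj:
  fixes U :: "int \<times> nat \<Rightarrow> 'a \<Rightarrow> real"
  assumes ind: "indep_vars (\<lambda>_. borel) U UNIV" and U: "\<And>i. uniform01 (U i)"
  shows "AE \<omega> in M. inj (\<lambda>i. real_of_int (fst i) + U (fst i, Suc (snd i)) \<omega>)"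
proof -
  let ?V = "\<lambda>i \<omega>. real_of_int (fst i) + U (fst i, Suc (snd i)) \<omega>"
  have "AE \<omega> in M. i \<noteq> j \<longrightarrow> ?V i \<omega> \<noteq> ?V j \<omega>" for i j
  proof (cases "i = j")
    case False
    then have "(fst i, Suc (snd i)) \<noteq> (fst j, Suc (snd j))"
      by (auto simp: prod_eq_iff)
    from uniform01_AE_distinct[OF U U indep_vars_imp_indep_var[OF ind this]]
    show ?thesis by auto
  qed simp
  then have "AE \<omega> in M. \<forall>i j. i \<noteq> j \<longrightarrow> ?V i \<omega> \<noteq> ?V j \<omega>"
    unfolding AE_all_countable by blast
  then show ?thesis
    by eventually_elim (auto simp: inj_def)
qed

text \<open>The product over the sets is regrouped by cells and by the points of each cell. Cells
  are independent and each contributes an exponential; the exponents add up because the pieces of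
  \<open>A i\<close> in the cells have total measure \<open>measure lborel (A i)\<close>. The result
  factorises over \<open>J\<close>, from which independence of the counts will follow.\<close>

lemma uniform_points_pgf:
  fixes U :: "int \<times> nat \<Rightarrow> 'a \<Rightarrow> real" and z :: "'i \<Rightarrow> real"
  assumes ind: "indep_vars (\<lambda>_. borel) U UNIV" and U: "\<And>i. uniform01 (U i)"
    and U01: "\<And>i \<omega>. \<omega> \<in> space M \<Longrightarrow> U i \<omega> \<in> {0..1}" and "\<mu> \<ge> 0"
    and J: "finite J" and A: "\<And>i. i \<in> J \<Longrightarrow> A i \<in> sets borel \<and> bounded (A i)" and disj: "disjoint_family_on A J"
    and z: "\<And>i. \<bar>z i\<bar> < 1"
  shows "expectation (\<lambda>\<omega>. \<Prod>i\<in>J. z i ^ card (uniform_points \<mu> U \<omega> \<inter> A i)) =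
    (\<Prod>i\<in>J. exp (\<mu> * measure lborel (A i) * (z i - 1)))"
proof -
  note [measurable] = conjunct1[OF A]
  have mU[measurable]: "U i \<in> borel_measurable M" for i
    using ind unfolding indep_vars_def by blast
  have "bounded (\<Union>i\<in>J. A i)"
    using J A by (intro bounded_UN) auto
  then obtain r where r: "(\<Union>i\<in>J. A i) \<subseteq> {-r..r}"
    using bounded_subset_cbox_symmetric by (metis interval_cbox)
  define a b where "a = \<lfloor>-r\<rfloor>" and "b = \<lceil>r\<rceil>"
  have AI: "A i \<subseteq> {real_of_int a..real_of_int b}" if "i \<in> J" for i
  proof
    fix x assume "x \<in> A i"
    then have "x \<in> {-r..r}" using r that by blast
    then show "x \<in> {real_of_int a..real_of_int b}"
      unfolding a_def b_def by (auto; linarith)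
  qed
  let ?I = "{a - 1..b}"
  let ?V = "\<lambda>i \<omega>. real_of_int (fst i) + U (fst i, Suc (snd i)) \<omega>"
  define h where "h x = (\<Prod>i\<in>J. if x \<in> A i then z i else 1)" for x
  have mh[measurable]: "h \<in> borel_measurable borel"
    unfolding h_def
  proof (rule borel_measurable_prod)
    fix i assume i: "i \<in> J"
    have "A i \<in> sets borel" using A[OF i] by simp
    then show "(\<lambda>x. if x \<in> A i then z i else 1) \<in> borel_measurable borel"
      by (intro measurable_If_set) auto
  qed
  have h1: "\<bar>h x\<bar> \<le> 1" for x
    unfolding h_def abs_prod using z by (intro prod_le_1) (auto intro: less_imp_le)
  define G where "G n \<omega> = (\<Prod>j<poisson_quantile \<mu> (U (n, 0) \<omega>). h (real_of_int n + U (n, Suc j) \<omega>))" for n \<omega>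
  have G1: "\<bar>G n \<omega>\<bar> \<le> 1" for n \<omega>
    unfolding G_def abs_prod using h1 by (intro prod_le_1) auto
  have EG: "expectation (G n) = exp (\<mu> * (\<Sum>i\<in>J. (z i - 1) * measure lborel ({real_of_int n..<real_of_int n + 1} \<inter> A i)))" for n
  proof -
    have "expectation (G n) = exp (\<mu> * ((\<integral>u. indicator {0..<1} u * h (real_of_int n + u) \<partial>lborel) - 1))"
      unfolding G_def[abs_def]
      by (rule expectation_poisson_cell[of "\<lambda>j. U (n, j)", OF indep_vars_reindex_inj[OF ind, of "Pair n"]])
        (use U h1 \<open>\<mu> \<ge> 0\<close> mh in \<open>auto simp: inj_def\<close>)
    also have "(\<integral>u. indicator {0..<1} u * h (real_of_int n + u) \<partial>lborel) - 1 =
        (\<Sum>i\<in>J. (z i - 1) * measure lborel ({real_of_int n..<real_of_int n + 1} \<inter> A i))"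
      unfolding h_def by (rule integral_unit_cell[OF J _ disj]) (use A in auto)
    finally show ?thesis .
  qed
  have indG: "indep_vars (\<lambda>_. borel) G ?I"
  proof -
    let ?K = "\<lambda>n::int. {n} \<times> (UNIV::nat set)"
    have "indep_vars (\<lambda>n. PiM (?K n) (\<lambda>_. borel)) (\<lambda>n \<omega>. restrict (\<lambda>i. U i \<omega>) (?K n)) ?I"
      by (rule indep_vars_restrict[OF ind]) (auto simp: disjoint_family_on_def)
    then have "indep_vars (\<lambda>_. borel) (\<lambda>n \<omega>. (\<Prod>j<poisson_quantile \<mu> (restrict (\<lambda>i. U i \<omega>) (?K n) (n, 0)).
        h (real_of_int n + restrict (\<lambda>i. U i \<omega>) (?K n) (n, Suc j)))) ?I"
    proof (rule indep_vars_compose2)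
      fix n :: int
      have [measurable]: "(\<lambda>g. g (n, j)) \<in> borel_measurable (PiM (?K n) (\<lambda>_. borel :: real measure))" for j
        by (rule measurable_component_singleton) simp
      \<comment> \<open>The number of factors is itself random, so measurability is obtained by
        splitting on its value.\<close>
      show "(\<lambda>g. \<Prod>j<poisson_quantile \<mu> (g (n, 0)). h (real_of_int n + g (n, Suc j)))
          \<in> borel_measurable (PiM (?K n) (\<lambda>_. borel))"
        by (rule measurable_compose_countable[where f = "\<lambda>k g. \<Prod>j<k. h (real_of_int n + g (n, Suc j))"]) measurable
    qed
    then show ?thesis
      by (simp add: G_def[abs_def])
  qed
  have mG: "G n \<in> borel_measurable M" for n
    unfolding G_def[abs_def]
    by (rule measurable_compose_countable[where f = "\<lambda>k \<omega>. \<Prod>j<k. h (real_of_int n + U (n, Suc j) \<omega>)"]) measurable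
  \<comment> \<open>The regrouping counts indices, so it is carried out for outcomes without
    coinciding points, that is, almost surely.\<close>
  have AE: "AE \<omega> in M. (\<Prod>i\<in>J. z i ^ card (uniform_points \<mu> U \<omega> \<inter> A i)) = (\<Prod>n\<in>?I. G n \<omega>)"
    using AE_uniform_points_inj[OF ind U] AE_space
  proof eventually_elim
    case (elim \<omega>)
    let ?T = "Sigma ?I (\<lambda>n. {..<poisson_quantile \<mu> (U (n, 0) \<omega>)})"
    have fin: "finite ?T" by simp
    have "(\<Prod>n\<in>?I. G n \<omega>) = (\<Prod>(n, j)\<in>?T. h (real_of_int n + U (n, Suc j) \<omega>))"
      unfolding G_def by (rule prod.Sigma) auto
    also have "\<dots> = (\<Prod>t\<in>?T. \<Prod>i\<in>J. if ?V t \<omega> \<in> A i then z i else 1)"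
      unfolding h_def by (rule prod.cong) (auto simp: split_beta)
    also have "\<dots> = (\<Prod>i\<in>J. \<Prod>t\<in>?T. if ?V t \<omega> \<in> A i then z i else 1)"
      by (rule prod.swap)
    also have "\<dots> = (\<Prod>i\<in>J. z i ^ card (uniform_points \<mu> U \<omega> \<inter> A i))"
    proof (rule prod.cong[OF refl])
      fix i assume i: "i \<in> J"
      have "(\<Prod>t\<in>?T. if ?V t \<omega> \<in> A i then z i else 1) = (\<Prod>t\<in>{t \<in> ?T. ?V t \<omega> \<in> A i}. z i)"
        by (rule prod.inter_filter[OF fin, symmetric])
      also have "\<dots> = z i ^ card (uniform_points \<mu> U \<omega> \<inter> A i)"
        using uniform_points_card_Int[of U \<omega> "A i" a b \<mu>] U01[OF elim(2)] elim(1) AI[OF i]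
        by (simp add: subset_iff)
      finally show "(\<Prod>t\<in>?T. if ?V t \<omega> \<in> A i then z i else 1) = z i ^ card (uniform_points \<mu> U \<omega> \<inter> A i)" .
    qed
    finally show ?case by simp
  qed
  have intG: "integrable M (G n)" for n
    by (rule integrable_const_bound[of _ 1]) (use G1 mG in auto)
  have mcard: "(\<lambda>\<omega>. card (uniform_points \<mu> U \<omega> \<inter> A i)) \<in> M \<rightarrow>\<^sub>M count_space UNIV" if "i \<in> J" for i
    by (rule measurable_compose[OF measurable_uniform_points[OF mU U01] measurable_card_Int])
      (use A[OF that] in auto)
  have "expectation (\<lambda>\<omega>. \<Prod>i\<in>J. z i ^ card (uniform_points \<mu> U \<omega> \<inter> A i)) = expectation (\<lambda>\<omega>. \<Prod>n\<in>?I. G n \<omega>)"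
  proof (rule integral_cong_AE[OF _ _ AE])
    show "(\<lambda>\<omega>. \<Prod>i\<in>J. z i ^ card (uniform_points \<mu> U \<omega> \<inter> A i)) \<in> borel_measurable M"
      by (intro borel_measurable_prod measurable_compose[OF mcard]) auto
  qed (intro borel_measurable_prod mG)
  also have "\<dots> = (\<Prod>n\<in>?I. expectation (G n))"
    by (rule indep_vars_lebesgue_integral[OF _ indG intG]) simp
  also have "\<dots> = exp (\<Sum>n\<in>?I. \<mu> * (\<Sum>i\<in>J. (z i - 1) * measure lborel ({real_of_int n..<real_of_int n + 1} \<inter> A i)))"
    by (simp only: EG exp_sum[OF finite_atLeastAtMost_int])
  also have "(\<Sum>n\<in>?I. \<mu> * (\<Sum>i\<in>J. (z i - 1) * measure lborel ({real_of_int n..<real_of_int n + 1} \<inter> A i))) =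
      (\<Sum>i\<in>J. \<mu> * (z i - 1) * (\<Sum>n\<in>?I. measure lborel ({real_of_int n..<real_of_int n + 1} \<inter> A i)))"
    by (simp only: sum_distrib_left mult.assoc) (rule sum.swap)
  also have "\<dots> = (\<Sum>i\<in>J. \<mu> * measure lborel (A i) * (z i - 1))"
    using measure_unit_cells A AI by (intro sum.cong refl) simp
  also have "exp \<dots> = (\<Prod>i\<in>J. exp (\<mu> * measure lborel (A i) * (z i - 1)))"
    by (rule exp_sum[OF J])
  finally show ?thesis .
qed

text \<open>The joint formula for a one-element family gives the Poisson marginals. Read with these
  marginals, the general formula says that joint probabilities factorise, which for counts with
  values in \<open>nat\<close> is independence.\<close>

lemma poisson_process_uniform_points:
  fixes U :: "int \<times> nat \<Rightarrow> 'a \<Rightarrow> real"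
  assumes ind: "indep_vars (\<lambda>_. borel) U UNIV" and U: "\<And>i. uniform01 (U i)"
    and U01: "\<And>i \<omega>. \<omega> \<in> space M \<Longrightarrow> U i \<omega> \<in> {0..1}" and "\<mu> \<ge> 0"
  shows "poisson_process M \<mu> (uniform_points \<mu> U)"
proof -
  have mU: "U i \<in> borel_measurable M" for i
    using ind unfolding indep_vars_def by blast
  have mX: "uniform_points \<mu> U \<in> M \<rightarrow>\<^sub>M point_configurations"
    by (rule measurable_uniform_points[OF mU U01])
  have mcard: "(\<lambda>\<omega>. card (uniform_points \<mu> U \<omega> \<inter> A)) \<in> M \<rightarrow>\<^sub>M count_space UNIV"
    if "A \<in> sets borel" "bounded A" for A
    by (rule measurable_compose[OF mX measurable_card_Int[OF that]])
  have joint: "prob {\<omega> \<in> space M. \<forall>i\<in>J. card (uniform_points \<mu> U \<omega> \<inter> A i) = k i} =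
      (\<Prod>i\<in>J. poisson_weight (\<mu> * measure lborel (A i)) (k i))"
    if "finite J" "\<And>i. i \<in> J \<Longrightarrow> A i \<in> sets borel \<and> bounded (A i)" "disjoint_family_on A J"
    for J :: "nat set" and A k
    by (rule joint_poisson_pgf_unique[OF that(1)])
      (use mcard that in \<open>auto intro!: uniform_points_pgf[OF ind U U01 \<open>\<mu> \<ge> 0\<close>]\<close>)
  have marginal: "prob {\<omega> \<in> space M. card (uniform_points \<mu> U \<omega> \<inter> A) = k} = poisson_weight (\<mu> * measure lborel A) k"
    if "A \<in> sets borel" "bounded A" for A k
    using joint[of "{0}" "\<lambda>_. A" "\<lambda>_. k"] that by (simp add: disjoint_family_on_def)
  have "indep_vars (\<lambda>_. count_space UNIV) (\<lambda>i \<omega>. card (uniform_points \<mu> U \<omega> \<inter> A i)) UNIV"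
    if A: "\<And>i. A i \<in> sets borel \<and> bounded (A i)" "disjoint_family A" for A :: "nat \<Rightarrow> real set"
  proof (rule indep_vars_countableI)
    show "(\<lambda>\<omega>. card (uniform_points \<mu> U \<omega> \<inter> A i)) \<in> M \<rightarrow>\<^sub>M count_space UNIV" for i
      using mcard A by blast
    fix J :: "nat set" and k assume J: "finite J"
    have "disjoint_family_on A J"
      using A(2) by (auto simp: disjoint_family_on_def)
    then show "prob {\<omega> \<in> space M. \<forall>i\<in>J. card (uniform_points \<mu> U \<omega> \<inter> A i) = k i} =
        (\<Prod>i\<in>J. prob {\<omega> \<in> space M. card (uniform_points \<mu> U \<omega> \<inter> A i) = k i})"
      using joint[OF J A(1)] marginal A(1) by simp
  qed
  then show ?thesis
    unfolding poisson_process_def using prob_space_axioms mX marginal by blast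
qed

end

section \<open>The equivalence\<close>

text \<open>\<open>\<Phi>\<close> is a measurable map of configurations, not merely a process on
  \<open>M\<close>, so that the images of two independent percolations under two such maps are again
  independent.\<close>

lemma poisson_process_from_bernoulli:
  assumes X: "bernoulli_percolation M p X" and "0 < p" "p < 1" "\<alpha> > 0"
  obtains \<Phi> where "\<Phi> \<in> integer_configurations \<rightarrow>\<^sub>M point_configurations"
    "poisson_process M \<alpha> (\<lambda>\<omega>. \<Phi> (X \<omega>))"
proof -
  interpret prob_space M using X by (simp add: bernoulli_percolation_def)
  obtain U :: "int \<times> nat \<Rightarrow> int set \<Rightarrow> real" where U:
    "\<And>i. U i \<in> borel_measurable integer_configurations" "\<And>i S. U i S \<in> {0..1}"
    "indep_vars (\<lambda>_. borel) (\<lambda>i \<omega>. U i (X \<omega>)) UNIV" "\<And>i. uniform01 (\<lambda>\<omega>. U i (X \<omega>))"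
    using bernoulli_percolation_uniforms[OF assms(1-3)] by metis
  show thesis
  proof (rule that)
    show "uniform_points \<alpha> U \<in> integer_configurations \<rightarrow>\<^sub>M point_configurations"
      by (rule measurable_uniform_points[OF U(1,2)])
    have "poisson_process M \<alpha> (uniform_points \<alpha> (\<lambda>i \<omega>. U i (X \<omega>)))"
      using U(2) \<open>\<alpha> > 0\<close> by (intro poisson_process_uniform_points U(3,4)) auto
    then show "poisson_process M \<alpha> (\<lambda>\<omega>. uniform_points \<alpha> U (X \<omega>))"
      by (simp add: uniform_points_def[abs_def])
  qed
qed

lemma bernoulli_if_poisson:
  assumes "poisson_as_rough_isometric TYPE('w) \<alpha> \<beta>" "0 < \<alpha>" "0 < \<beta>" "0 < p" "p < 1" "0 < q" "q < 1"
  shows "bernoulli_as_rough_isometric TYPE('w) p q"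
  unfolding bernoulli_as_rough_isometric_def
proof safe
  fix M :: "'w measure" and X Y
  assume X: "bernoulli_percolation M p X" and Y: "bernoulli_percolation M q Y"
    and XY: "prob_space.indep_var M integer_configurations X integer_configurations Y"
  interpret prob_space M using X by (simp add: bernoulli_percolation_def)
  obtain \<Phi> where \<Phi>: "\<Phi> \<in> integer_configurations \<rightarrow>\<^sub>M point_configurations" "poisson_process M \<alpha> (\<lambda>\<omega>. \<Phi> (X \<omega>))"
    using poisson_process_from_bernoulli[OF X] assms by metis
  obtain \<Psi> where \<Psi>: "\<Psi> \<in> integer_configurations \<rightarrow>\<^sub>M point_configurations" "poisson_process M \<beta> (\<lambda>\<omega>. \<Psi> (Y \<omega>))"
    using poisson_process_from_bernoulli[OF Y] assms by metis
  obtain L where L: "L > 0" "1 - exp (- (\<alpha> * L)) = p"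
    using grid_parameter assms by metis
  obtain L' where L': "L' > 0" "1 - exp (- (\<beta> * L')) = q"
    using grid_parameter assms by metis
  have ind: "indep_var point_configurations (\<lambda>\<omega>. \<Phi> (X \<omega>)) point_configurations (\<lambda>\<omega>. \<Psi> (Y \<omega>))"
    using indep_var_compose[OF XY \<Phi>(1) \<Psi>(1)] by (simp add: comp_def)
  \<comment> \<open>The transfer runs from \<open>M\<close> to itself: the grids of
    \<open>\<Phi> (X \<omega>)\<close> and \<open>\<Psi> (Y \<omega>)\<close> form the second pair,
    and their rough isometry comes from the Poisson hypothesis.\<close>
  show "AE \<omega> in M. rough_isometric (real_of_int ` X \<omega>) (real_of_int ` Y \<omega>)"
  proof (rule AE_rough_isometric_bernoulli_transfer[OF X Y XY])
    show "bernoulli_percolation M p (\<lambda>\<omega>. grid L (\<Phi> (X \<omega>)))"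
      using bernoulli_percolation_grid[OF \<Phi>(2) \<open>0 < \<alpha>\<close> L(1)] unfolding L(2) .
    show "bernoulli_percolation M q (\<lambda>\<omega>. grid L' (\<Psi> (Y \<omega>)))"
      using bernoulli_percolation_grid[OF \<Psi>(2) \<open>0 < \<beta>\<close> L'(1)] unfolding L'(2) .
    show "indep_var integer_configurations (\<lambda>\<omega>. grid L (\<Phi> (X \<omega>))) integer_configurations (\<lambda>\<omega>. grid L' (\<Psi> (Y \<omega>)))"
      by (rule indep_var_grid[OF \<Phi>(2) ind])
    have "AE \<omega> in M. rough_isometric (\<Phi> (X \<omega>)) (\<Psi> (Y \<omega>))"
      using assms(1) \<Phi>(2) \<Psi>(2) ind unfolding poisson_as_rough_isometric_def by blast
    then show "AE \<omega> in M. rough_isometric (real_of_int ` grid L (\<Phi> (X \<omega>))) (real_of_int ` grid L' (\<Psi> (Y \<omega>)))"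
      by (simp only: rough_isometric_grid_iff[OF L(1) L'(1)])
  qed
qed

theorem proposition2p2:
  shows "((\<exists>\<alpha> \<beta>. 0 < \<alpha> \<and> 0 < \<beta> \<and> poisson_as_rough_isometric TYPE('w) \<alpha> \<beta>) \<longleftrightarrow>
          (\<forall>\<alpha> \<beta>. 0 < \<alpha> \<longrightarrow> 0 < \<beta> \<longrightarrow> poisson_as_rough_isometric TYPE('w) \<alpha> \<beta>)) \<and>
         ((\<forall>\<alpha> \<beta>. 0 < \<alpha> \<longrightarrow> 0 < \<beta> \<longrightarrow> poisson_as_rough_isometric TYPE('w) \<alpha> \<beta>) \<longleftrightarrow>
          (\<exists>p q. 0 < p \<and> p < 1 \<and> 0 < q \<and> q < 1 \<and> bernoulli_as_rough_isometric TYPE('w) p q)) \<and>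
         ((\<exists>p q. 0 < p \<and> p < 1 \<and> 0 < q \<and> q < 1 \<and> bernoulli_as_rough_isometric TYPE('w) p q) \<longleftrightarrow>
          (\<forall>p q. 0 < p \<longrightarrow> p < 1 \<longrightarrow> 0 < q \<longrightarrow> q < 1 \<longrightarrow> bernoulli_as_rough_isometric TYPE('w) p q))"
    (is "(?i \<longleftrightarrow> ?ii) \<and> (?ii \<longleftrightarrow> ?iii) \<and> (?iii \<longleftrightarrow> ?iv)")
proof -
  have "?i \<Longrightarrow> ?iv"
    using bernoulli_if_poisson by blast
  moreover have "?iv \<Longrightarrow> ?iii"
    by (intro exI[of _ "1 / 2 :: real"]) auto
  moreover have "?iii \<Longrightarrow> ?ii"
    using poisson_if_bernoulli by blast
  moreover have "?ii \<Longrightarrow> ?i"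
    by (intro exI[of _ "1 :: real"]) auto
  ultimately show ?thesis
    by argo
qed

end
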